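(* Let $k$ be a field of characteristic zero, $m\geq 2$, $R=k[x_0,\ldots,x_{2m-2}]$, and let $\mathcal{H}_m=(x_{i+j})_{0\le i,j\le m-1}$ be the generic $m\times m$ Hankel matrix. Let $J\subset R$ be the gradient ideal of $\det\mathcal{H}_m$ and let $P:=I_{m-1}(\mathcal{H}_m)\subset R$ be the ideal generated by the $(m-1)$-minors of $\mathcal{H}_m$. Then the minimal component of the primary decomposition of $J$ in $R$ is $P$; that is, $P=\sqrt{J}$ is the unique minimal prime of $J$, and the $P$-primary component of $J$ is $P$ itself.
   Context: The gradient ideal of a polynomial $f\in k[x_0,\ldots,x_n]$ is the ideal generated by all the partial derivatives $\partial f/\partial x_0,\ldots,\partial f/\partial x_n$. For a matrix $M$, $I_t(M)$ denotes the ideal generated by its $t\times t$ minors. *)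

theory Defs
  imports
    "HOL-Library.Poly_Mapping"
    "HOL-Algebra.Ideal"
    "Jordan_Normal_Form.Determinant"
    "Jordan_Normal_Form.DL_Submatrix"
begin

section \<open>Polynomial rings in finitely many variables\<close>

text \<open>
  A monomial is a finitely supported exponent function, and a polynomial is a finitely supported
  function from monomials to coefficients. All variables \<open>x\<^sub>0, x\<^sub>1, \<dots>\<close> live in one
  type; the ring \<open>k[x\<^sub>i | i \<in> V]\<close> is cut out as a carrier set.
\<close>

type_synonym 'a mpolynomial = "(nat \<Rightarrow>\<^sub>0 nat) \<Rightarrow>\<^sub>0 'a"

definition Var :: "nat \<Rightarrow> 'a::comm_ring_1 mpolynomial" where
  "Var i = Poly_Mapping.single (Poly_Mapping.single i 1) 1"

definition poly_ring :: "nat set \<Rightarrow> 'a::comm_ring_1 mpolynomial ring" where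
  "poly_ring V =
    \<lparr>carrier = {p. \<forall>m \<in> Poly_Mapping.keys p. Poly_Mapping.keys m \<subseteq> V},
     monoid.mult = (*), one = 1, zero = 0, add = (+)\<rparr>"

text \<open>
  The truncated subtraction on exponents is harmless: a monomial not containing the variable
  contributes the coefficient \<open>0\<close>.
\<close>

definition partial_deriv :: "nat \<Rightarrow> 'a::comm_ring_1 mpolynomial \<Rightarrow> 'a mpolynomial" where
  "partial_deriv i p =
    (\<Sum>m \<in> Poly_Mapping.keys p.
      Poly_Mapping.single (m - Poly_Mapping.single i 1)
        (of_nat (Poly_Mapping.lookup m i) * Poly_Mapping.lookup p m))"

definition gradient_ideal :: "nat set \<Rightarrow> 'a::comm_ring_1 mpolynomial \<Rightarrow> 'a mpolynomial set" where
  "gradient_ideal V f = Idl\<^bsub>poly_ring V\<^esub> {partial_deriv i f | i. i \<in> V}"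

lemma poly_ring_simps [simp]:
  "monoid.mult (poly_ring V) = (*)" "one (poly_ring V) = 1"
  "zero (poly_ring V) = 0" "add (poly_ring V) = (+)"
  by (simp_all add: poly_ring_def)

lemma mem_carrier_poly_ring:
  "p \<in> carrier (poly_ring V) \<longleftrightarrow> (\<forall>m \<in> Poly_Mapping.keys p. Poly_Mapping.keys m \<subseteq> V)"
  by (simp add: poly_ring_def)

lemma poly_ring_cring: "cring (poly_ring V :: 'a::comm_ring_1 mpolynomial ring)"
proof (rule cringI)
  let ?C = "carrier (poly_ring V :: 'a mpolynomial ring)"
  have add: "p + q \<in> ?C" if "p \<in> ?C" "q \<in> ?C" for p q
    using that Poly_Mapping.keys_add[of p q] unfolding mem_carrier_poly_ring by blast
  have uminus: "- p \<in> ?C" if "p \<in> ?C" for p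
    using that unfolding mem_carrier_poly_ring by simp
  have mult: "p * q \<in> ?C" if p: "p \<in> ?C" and q: "q \<in> ?C" for p q
    unfolding mem_carrier_poly_ring
  proof
    fix m assume "m \<in> Poly_Mapping.keys (p * q)"
    then obtain a b where "a \<in> Poly_Mapping.keys p" "b \<in> Poly_Mapping.keys q" "m = a + b"
      using Poly_Mapping.keys_mult[of p q] by blast
    then show "Poly_Mapping.keys m \<subseteq> V"
      using p q Poly_Mapping.keys_add[of a b] unfolding mem_carrier_poly_ring by blast
  qed
  have one: "1 \<in> ?C"
    unfolding mem_carrier_poly_ring by simp
  have zero: "0 \<in> ?C"
    unfolding mem_carrier_poly_ring by simp
  show "abelian_group (poly_ring V :: 'a mpolynomial ring)"
    by (rule abelian_groupI) (auto simp: add zero algebra_simps intro: bexI[OF _ uminus])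
  show "Group.comm_monoid (poly_ring V :: 'a mpolynomial ring)"
    by (rule Group.comm_monoidI) (auto simp: mult one algebra_simps)
qed (auto simp: algebra_simps)


section \<open>Determinantal ideals and the generic Hankel matrix\<close>

definition minors :: "nat \<Rightarrow> 'a::comm_ring_1 mat \<Rightarrow> 'a set" where
  "minors t M =
    {det (submatrix M I J) | I J.
      I \<subseteq> {..<dim_row M} \<and> J \<subseteq> {..<dim_col M} \<and> card I = t \<and> card J = t}"

definition minor_ideal ::
  "nat set \<Rightarrow> nat \<Rightarrow> 'a::comm_ring_1 mpolynomial mat \<Rightarrow> 'a mpolynomial set" where
  "minor_ideal V t M = Idl\<^bsub>poly_ring V\<^esub> (minors t M)"

definition hankel :: "nat \<Rightarrow> 'a::comm_ring_1 mpolynomial mat" where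
  "hankel m = mat m m (\<lambda>(i, j). Var (i + j))"


section \<open>Radicals, minimal primes and primary decompositions\<close>

definition radical :: "('a, 'b) ring_scheme \<Rightarrow> 'a set \<Rightarrow> 'a set" where
  "radical R I = {x \<in> carrier R. \<exists>n::nat. x [^]\<^bsub>R\<^esub> n \<in> I}"

definition minimal_primes :: "('a, 'b) ring_scheme \<Rightarrow> 'a set \<Rightarrow> 'a set set" where
  "minimal_primes R I =
    {P. primeideal P R \<and> I \<subseteq> P \<and> (\<forall>Q. primeideal Q R \<and> I \<subseteq> Q \<and> Q \<subseteq> P \<longrightarrow> Q = P)}"

definition primary_ideal :: "('a, 'b) ring_scheme \<Rightarrow> 'a set \<Rightarrow> bool" where
  "primary_ideal R Q \<longleftrightarrow>
    ideal Q R \<and> Q \<noteq> carrier R \<and>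
    (\<forall>x \<in> carrier R. \<forall>y \<in> carrier R.
      x \<otimes>\<^bsub>R\<^esub> y \<in> Q \<longrightarrow> x \<in> Q \<or> y \<in> radical R Q)"

text \<open>
  A primary decomposition is the finite set of its components; it is minimal if no component is
  redundant and distinct components have distinct radicals. Intersecting with the carrier makes
  the empty intersection the unit ideal.
\<close>

definition minimal_primary_decomposition ::
  "('a, 'b) ring_scheme \<Rightarrow> 'a set \<Rightarrow> 'a set set \<Rightarrow> bool" where
  "minimal_primary_decomposition R I D \<longleftrightarrow>
    finite D \<and> (\<forall>Q \<in> D. primary_ideal R Q) \<and>
    carrier R \<inter> \<Inter>D = I \<and>
    (\<forall>Q \<in> D. carrier R \<inter> \<Inter>(D - {Q}) \<noteq> I) \<and>
    inj_on (radical R) D"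

end

theory Submission
  imports Defs "HOL-Algebra.Ring_Divisibility"
begin

text \<open>
  Write \<open>m = r + 2\<close>, let \<open>H\<close> be the Hankel matrix, \<open>f\<close> its determinant and \<open>C a b\<close> its
  cofactors. A derivation acts on a determinant entry by entry, so
  \<open>\<partial>f/\<partial>x\<^sub>i = (\<Sum>a + b = i. C a b)\<close>: the gradient ideal \<open>J\<close> is generated by the antidiagonal
  sums of the cofactors, and \<open>P\<close> by the cofactors themselves. In particular \<open>J \<subseteq> P\<close>, and Laplace
  expansion gives Euler's formula \<open>m f = (\<Sum>i. x\<^sub>i \<partial>f/\<partial>x\<^sub>i)\<close>, whence \<open>f \<in> J\<close> in characteristic
  zero. The theorem rests on three facts.

  First, \<open>P \<subseteq> \<surd>J\<close> (\<open>hankel_minors_subset_radical\<close>). Modulo \<open>f\<close> the adjugate has rank at most one, in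
  the form \<open>C a a * C b b \<equiv> (C a b)\<^sup>2\<close>. The last antidiagonal consists of a single diagonal cofactor,
  which therefore lies in \<open>J\<close>; by the congruence its whole row lies in \<open>\<surd>J\<close>; these entries can then
  be dropped from the antidiagonal sums, and the argument moves up the diagonal.

  Second, \<open>J\<close> and \<open>P\<close> agree where the leading minor \<open>\<Delta>\<close> of order \<open>r\<close> is invertible:
  \<open>\<Delta>\<^sup>3 P \<subseteq> J\<close> (\<open>leading_minor_cubed_times_minors\<close>). Modulo \<open>J\<close> the columns of the adjugate are
  killed by \<open>H\<close>, so after multiplication by \<open>\<Delta>\<close> they are determined by their last two entries.
  The last three antidiagonal sums dispose of those, at the cost of further factors \<open>\<Delta>\<close>.

  Third, \<open>P\<close> is prime and does not contain \<open>\<Delta>\<close> (\<open>primeideal_hankel_minors\<close>,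
  \<open>leading_minor_notin_hankel_minors\<close>). Let \<open>\<phi>\<close> be the substitution \<open>x\<^sub>i \<mapsto> (\<Sum>j<r. c\<^sub>j * t\<^sub>j\<^sup>i)\<close>,
  which parametrises the \<open>r\<close>-secants of the rational normal curve. It turns \<open>H\<close> into a matrix
  of rank at most \<open>r\<close>, so \<open>P\<close> lies in its kernel. Weigh \<open>x\<^sub>i\<close> by \<open>i\<^sup>2\<close>. By the rearrangement
  inequality the diagonal term of each submaximal minor is strictly the heaviest one, and the
  diagonals are precisely the products \<open>x\<^bsub>a 0\<^esub> \<cdots> x\<^bsub>a r\<^esub>\<close> whose indices increase in steps of at
  least two. Hence every polynomial is congruent modulo \<open>P\<close> to a combination of monomials divisible
  by none of these products (\<open>straightening\<close>). The variables of such a monomial are covered by \<open>r\<close>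
  pairs \<open>{b, b + 1}\<close>, and \<open>\<phi>\<close> keeps these monomials linearly independent
  (\<open>coverable_independent\<close>): split a monomial into \<open>r\<close> factors, one for each pair, and look at
  the coefficient in its image at the degrees and index sums of the factors. Among all monomials of
  given degree and index sum, the one supported on two neighbouring variables is strictly the
  lightest, so only the monomial itself and strictly heavier ones contribute to that coefficient.
  Therefore \<open>P = ker \<phi>\<close> is prime. The monomials of \<open>\<Delta>\<close> have degree \<open>r\<close>, so all of them are covered
  by \<open>r\<close> pairs, and \<open>\<phi> \<Delta> \<noteq> 0\<close>.

  Together these give \<open>P = \<surd>J\<close> and the uniqueness of the minimal prime. If \<open>Q\<close> is a primary
  component of \<open>J\<close> with radical \<open>P\<close>, then \<open>\<Delta>\<^sup>3 P \<subseteq> J \<subseteq> Q\<close> and \<open>\<Delta>\<^sup>3 \<notin> P\<close> force \<open>P \<subseteq> Q\<close>, hence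
  \<open>Q = P\<close>. That minimal primary decompositions exist is the Lasker--Noether theorem; the polynomial
  ring is Noetherian by Dickson's lemma.
\<close>

section \<open>Primary decomposition in Noetherian rings\<close>

locale noetherian_cring = noetherian_ring + cring

lemma (in noetherian_ring) ideal_family_has_maximal:
  assumes "S \<noteq> {}" and "\<And>I. I \<in> S \<Longrightarrow> ideal I R"
  shows "\<exists>M\<in>S. \<forall>I\<in>S. M \<subseteq> I \<longrightarrow> I = M"
proof (rule subset_Zorn)
  fix C assume C: "subset.chain S C"
  show "\<exists>U\<in>S. \<forall>X\<in>C. X \<subseteq> U"
  proof (cases "C = {}")
    case True
    with assms(1) show ?thesis by auto
  next
    case False
    have "subset.chain {I. ideal I R} C"
      using C assms(2) unfolding pred_on.chain_def by auto
    from ideal_chain_is_trivial[OF False this] have "\<Union>C \<in> C" .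
    moreover have "C \<subseteq> S" using C unfolding pred_on.chain_def by auto
    ultimately show ?thesis by blast
  qed
qed

text \<open>
  Let \<open>x \<otimes> y \<in> Q\<close>. The colon ideals \<open>Q : y\<^sup>n\<close> increase and become stationary at some \<open>n\<close>; then
  \<open>Q\<close> is the intersection of \<open>Q + (y\<^sup>n)\<close> and \<open>Q + (x)\<close>, and irreducibility decides which of \<open>x\<close> and
  \<open>y\<^sup>n\<close> lies in \<open>Q\<close>.
\<close>

lemma (in noetherian_cring) irreducible_ideal_is_primary:
  assumes Q: "ideal Q R" "Q \<noteq> carrier R"
    and irr: "\<And>A B. \<lbrakk>ideal A R; ideal B R; A \<inter> B = Q\<rbrakk> \<Longrightarrow> A = Q \<or> B = Q"
  shows "primary_ideal R Q"
proof -
  interpret Q: ideal Q R by (rule Q)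
  have "y \<in> radical R Q"
    if x: "x \<in> carrier R" and y: "y \<in> carrier R" and xy: "x \<otimes> y \<in> Q" and xQ: "x \<notin> Q" for x y
  proof -
    define K where "K n = {a \<in> carrier R. a \<otimes> y [^] n \<in> Q}" for n :: nat
    have Kid: "ideal (K n) R" for n
    proof (rule idealI[OF ring_axioms])
      show "subgroup (K n) (add_monoid R)"
      proof (rule add.subgroupI)
        show "K n \<subseteq> carrier R" by (auto simp: K_def)
        have "\<zero> \<in> K n" using y by (simp add: K_def)
        then show "K n \<noteq> {}" by blast
      next
        fix a assume "a \<in> K n"
        then show "\<ominus> a \<in> K n" using y by (simp add: K_def l_minus)
      next
        fix a b assume "a \<in> K n" "b \<in> K n"
        then show "a \<oplus> b \<in> K n" using y by (simp add: K_def l_distr)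
      qed
    next
      fix a b assume ab: "a \<in> K n" "b \<in> carrier R"
      then have "b \<otimes> (a \<otimes> y [^] n) \<in> Q" by (auto simp: K_def intro: Q.I_l_closed)
      then show "b \<otimes> a \<in> K n" using ab y by (simp add: K_def m_assoc)
      then show "a \<otimes> b \<in> K n" using ab by (simp add: K_def m_comm)
    qed
    have Kmono: "K n \<subseteq> K (Suc n)" for n
    proof
      fix a assume a: "a \<in> K n"
      then have "(a \<otimes> y [^] n) \<otimes> y \<in> Q" using y by (auto simp: K_def intro: Q.I_r_closed)
      then show "a \<in> K (Suc n)" using a y by (simp add: K_def m_assoc)
    qed
    have "\<exists>M\<in>range K. \<forall>I\<in>range K. M \<subseteq> I \<longrightarrow> I = M"
      by (rule ideal_family_has_maximal) (use Kid in auto)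
    then obtain n where n: "\<And>k. K n \<subseteq> K k \<Longrightarrow> K k = K n" by auto
    have Kn: "K (Suc n) = K n" by (rule n[OF Kmono])
    let ?A = "Q <+>\<^bsub>R\<^esub> PIdl (y [^] n)" and ?B = "Q <+>\<^bsub>R\<^esub> PIdl x"
    have id: "ideal ?A R" "ideal ?B R"
      using Q x y by (auto intro!: add_ideals cgenideal_ideal)
    have mem: "z \<in> Q <+>\<^bsub>R\<^esub> PIdl w \<longleftrightarrow> (\<exists>q\<in>Q. \<exists>a\<in>carrier R. z = q \<oplus> a \<otimes> w)" for z w
      unfolding set_add_def' cgenideal_def by blast
    have sub: "Q \<subseteq> Q <+>\<^bsub>R\<^esub> PIdl w" if w: "w \<in> carrier R" for w
    proof
      fix q assume "q \<in> Q"
      then have "q = q \<oplus> \<zero> \<otimes> w" using w Q.a_subset by auto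
      then show "q \<in> Q <+>\<^bsub>R\<^esub> PIdl w" unfolding mem using \<open>q \<in> Q\<close> by blast
    qed
    have gen: "w \<in> Q <+>\<^bsub>R\<^esub> PIdl w" if w: "w \<in> carrier R" for w
    proof -
      have "w = \<zero> \<oplus> \<one> \<otimes> w" using w by simp
      then show ?thesis unfolding mem using Q.zero_closed by blast
    qed
    have cancel: "u \<oplus> w \<oplus> \<ominus> u = w" if "u \<in> carrier R" "w \<in> carrier R" for u w
      using that by (metis a_comm a_assoc r_neg r_zero a_inv_closed)
    have "?A \<inter> ?B \<subseteq> Q"
    proof
      fix z assume "z \<in> ?A \<inter> ?B"
      then obtain q a q' b where z: "q \<in> Q" "a \<in> carrier R" "z = q \<oplus> a \<otimes> y [^] n"
        "q' \<in> Q" "b \<in> carrier R" "z = q' \<oplus> b \<otimes> x" unfolding Int_iff mem by blast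
      have qc: "q \<in> carrier R" "q' \<in> carrier R" using z Q.a_subset by auto
      have "z \<otimes> y = q' \<otimes> y \<oplus> b \<otimes> (x \<otimes> y)"
        using z(5) qc x y unfolding z(6) by (simp add: l_distr m_assoc)
      also have "\<dots> \<in> Q" using z(4,5) xy y Q.I_r_closed Q.I_l_closed by (intro Q.a_closed) auto
      finally have "z \<otimes> y \<in> Q" .
      moreover have "q \<otimes> y \<in> Q" using z y by (intro Q.I_r_closed)
      ultimately have "z \<otimes> y \<oplus> \<ominus> (q \<otimes> y) \<in> Q" by (intro Q.a_closed Q.a_inv_closed)
      also have "z \<otimes> y \<oplus> \<ominus> (q \<otimes> y) = a \<otimes> y [^] Suc n"
        using z(2) qc y cancel[of "q \<otimes> y" "a \<otimes> (y [^] n \<otimes> y)"] unfolding z(3)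
        by (simp add: l_distr m_assoc)
      finally have "a \<in> K (Suc n)" using z by (simp add: K_def)
      then have "a \<otimes> y [^] n \<in> Q" unfolding Kn by (simp add: K_def)
      then show "z \<in> Q" using z by simp
    qed
    with sub have "?A \<inter> ?B = Q" using x y by blast
    with irr id gen[OF x] xQ have "?A = Q" by blast
    with gen[of "y [^] n"] y have "y [^] n \<in> Q" by auto
    then show ?thesis using y by (auto simp: radical_def)
  qed
  then show ?thesis unfolding primary_ideal_def using Q by blast
qed

text \<open>
  Noetherian induction: an ideal maximal among those without a decomposition cannot be an
  intersection of two larger ideals, so it is irreducible, hence primary, which is a contradiction. The unit ideal is
  decomposed by the empty set.
\<close>

lemma (in noetherian_cring) primary_decomposition_exists:
  assumes "ideal I R"
  shows "\<exists>D. finite D \<and> (\<forall>Q\<in>D. primary_ideal R Q) \<and> carrier R \<inter> \<Inter>D = I"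
proof -
  define dec where
    "dec I \<longleftrightarrow> (\<exists>D. finite D \<and> (\<forall>Q\<in>D. primary_ideal R Q) \<and> carrier R \<inter> \<Inter>D = I)" for I
  have "dec I"
  proof (rule ccontr)
    assume "\<not> dec I"
    then have "\<exists>M\<in>{I. ideal I R \<and> \<not> dec I}. \<forall>I\<in>{I. ideal I R \<and> \<not> dec I}. M \<subseteq> I \<longrightarrow> I = M"
      using assms by (intro ideal_family_has_maximal) blast+
    then obtain M where M: "ideal M R" "\<not> dec M"
      and max: "\<And>I. \<lbrakk>ideal I R; \<not> dec I; M \<subseteq> I\<rbrakk> \<Longrightarrow> I = M"
      by auto
    have "dec (carrier R)" unfolding dec_def by (rule exI[of _ "{}"]) auto
    with M have proper: "M \<noteq> carrier R" by metis
    have Mc: "M \<subseteq> carrier R" using M(1) ideal.axioms(1) additive_subgroup.a_subset by blast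
    have "primary_ideal R M"
    proof (rule irreducible_ideal_is_primary[OF M(1) proper])
      fix A B assume AB: "ideal A R" "ideal B R" "A \<inter> B = M"
      show "A = M \<or> B = M"
      proof (rule ccontr)
        assume "\<not> (A = M \<or> B = M)"
        with max[of A] max[of B] AB have "dec A" "dec B" by blast+
        then obtain D E where "finite D" "\<forall>Q\<in>D. primary_ideal R Q" "carrier R \<inter> \<Inter>D = A"
          "finite E" "\<forall>Q\<in>E. primary_ideal R Q" "carrier R \<inter> \<Inter>E = B"
          unfolding dec_def by blast
        then have "finite (D \<union> E) \<and> (\<forall>Q\<in>D \<union> E. primary_ideal R Q) \<and> carrier R \<inter> \<Inter>(D \<union> E) = M"
          using AB(3) by blast
        with M(2) show False unfolding dec_def by blast
      qed
    qed
    then have "dec M" unfolding dec_def using Mc by (intro exI[of _ "{M}"]) auto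
    with M show False by blast
  qed
  then show ?thesis by (simp add: dec_def)
qed

lemma (in cring) radical_Int_ideals:
  assumes "ideal A R" "ideal B R"
  shows "radical R (A \<inter> B) = radical R A \<inter> radical R B"
proof
  show "radical R A \<inter> radical R B \<subseteq> radical R (A \<inter> B)"
  proof
    fix x assume "x \<in> radical R A \<inter> radical R B"
    then obtain k l :: nat where x: "x \<in> carrier R" "x [^] k \<in> A" "x [^] l \<in> B"
      by (auto simp: radical_def)
    then have "x [^] k \<otimes> x [^] l \<in> A \<inter> B"
      using assms by (auto intro: ideal.I_r_closed ideal.I_l_closed)
    with x show "x \<in> radical R (A \<inter> B)" by (auto simp: radical_def nat_pow_mult)
  qed
qed (auto simp: radical_def)

lemma (in cring) primary_ideal_Int:
  assumes A: "primary_ideal R A" and B: "primary_ideal R B" and rad: "radical R A = radical R B"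
  shows "primary_ideal R (A \<inter> B)" "radical R (A \<inter> B) = radical R A"
proof -
  have id: "ideal A R" "ideal B R" using A B by (auto simp: primary_ideal_def)
  show r: "radical R (A \<inter> B) = radical R A" using radical_Int_ideals[OF id] rad by simp
  have "A \<subseteq> carrier R" "A \<noteq> carrier R"
    using A id(1) by (auto simp: primary_ideal_def dest: ideal.Icarr)
  then have "A \<inter> B \<noteq> carrier R" by blast
  moreover have "ideal (A \<inter> B) R" using id by (rule i_intersect)
  ultimately show "primary_ideal R (A \<inter> B)"
    using A B rad unfolding primary_ideal_def r by blast
qed

text \<open>
  A decomposition with the least number of components is minimal: a redundant component could be
  omitted, and two components with the same radical could be replaced by their intersection.
\<close>

theorem (in noetherian_cring) minimal_primary_decomposition_exists:
  assumes "ideal I R"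
  shows "\<exists>D. minimal_primary_decomposition R I D"
proof -
  define dec where "dec D \<longleftrightarrow> finite D \<and> (\<forall>Q\<in>D. primary_ideal R Q) \<and> carrier R \<inter> \<Inter>D = I" for D
  have "\<exists>D. dec D" unfolding dec_def by (rule primary_decomposition_exists[OF assms])
  then obtain D where D: "dec D" and least: "\<And>E. dec E \<Longrightarrow> card D \<le> card E"
    using ex_has_least_nat[of dec _ card] by blast
  have fin: "finite D" using D by (simp add: dec_def)
  have irred: "carrier R \<inter> \<Inter>(D - {Q}) \<noteq> I" if Q: "Q \<in> D" for Q
  proof
    assume "carrier R \<inter> \<Inter>(D - {Q}) = I"
    then have "dec (D - {Q})" using D by (auto simp: dec_def)
    from least[OF this] show False using Q fin card_Diff1_less[OF fin Q] by linarith
  qed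
  have "inj_on (radical R) D"
  proof (rule inj_onI, rule ccontr)
    fix A B assume AB: "A \<in> D" "B \<in> D" "radical R A = radical R B" "A \<noteq> B"
    let ?E = "insert (A \<inter> B) (D - {A} - {B})"
    have "primary_ideal R (A \<inter> B)" using AB D by (intro primary_ideal_Int) (auto simp: dec_def)
    moreover have "\<Inter>?E = \<Inter>D" using AB by blast
    ultimately have "dec ?E" using D by (auto simp: dec_def)
    from least[OF this] have "card D \<le> card ?E" .
    also have "card ?E \<le> Suc (card (D - {A} - {B}))" by (rule card_insert_le_m1) auto
    also have "\<dots> = Suc (card D - 2)" using AB fin by (simp add: card_Diff_singleton)
    finally have "card D \<le> Suc (card D - 2)" .
    moreover have "card {A, B} \<le> card D" using AB fin by (intro card_mono) auto
    ultimately show False using AB by simp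
  qed
  with D irred have "minimal_primary_decomposition R I D"
    unfolding minimal_primary_decomposition_def dec_def by blast
  then show ?thesis by blast
qed

lemma (in cring) prime_power_mem:
  assumes P: "primeideal P R" and y: "y \<in> carrier R" "y [^] (n::nat) \<in> P"
  shows "y \<in> P"
  using y(2)
proof (induction n)
  case 0
  then have "P = carrier R" using ideal.one_imp_carrier[OF primeideal.axioms(1)[OF P]] by simp
  then show ?case using y by simp
next
  case (Suc n)
  then show ?case using primeideal.I_prime[OF P, of "y [^] n" y] y by auto
qed

lemma (in cring) radical_subset_prime:
  assumes "primeideal P R" "I \<subseteq> P"
  shows "radical R I \<subseteq> P"
  using assms prime_power_mem by (auto simp: radical_def)

lemma (in cring) ideal_subset_radical:
  assumes "ideal I R"
  shows "I \<subseteq> radical R I"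
proof
  fix x assume x: "x \<in> I"
  then have "x \<in> carrier R" by (rule ideal.Icarr[OF assms])
  then have "x [^] (1::nat) \<in> I" using x by simp
  with \<open>x \<in> carrier R\<close> show "x \<in> radical R I" unfolding radical_def by blast
qed

lemma (in cring) minimal_primes_of_prime_radical:
  assumes J: "ideal J R" and P: "primeideal P R" and rad: "P = radical R J"
  shows "minimal_primes R J = {P}"
proof -
  have JP: "J \<subseteq> P" unfolding rad by (rule ideal_subset_radical[OF J])
  have "P \<subseteq> Q" if "primeideal Q R" "J \<subseteq> Q" for Q
    unfolding rad by (rule radical_subset_prime[OF that])
  then show ?thesis unfolding minimal_primes_def using P JP by blast
qed

lemma (in cring) Inter_not_subset_prime:
  assumes P: "primeideal P R" and "finite D" and "\<And>Q. Q \<in> D \<Longrightarrow> ideal Q R \<and> \<not> Q \<subseteq> P"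
  shows "\<exists>x\<in>carrier R \<inter> \<Inter>D. x \<notin> P"
  using assms(2,3)
proof (induction D)
  case empty
  have "\<one> \<notin> P"
    using ideal.one_imp_carrier[OF primeideal.axioms(1)[OF P]] primeideal.I_notcarr[OF P] by auto
  then show ?case by (intro bexI[of _ \<one>]) auto
next
  case (insert Q D)
  then obtain x where x: "x \<in> carrier R" "x \<in> \<Inter>D" "x \<notin> P" by auto
  from insert.prems[of Q] have Q: "ideal Q R" "\<not> Q \<subseteq> P" by auto
  then obtain q where q: "q \<in> Q" "q \<notin> P" by blast
  have qc: "q \<in> carrier R" by (rule ideal.Icarr[OF Q(1) q(1)])
  have "x \<otimes> q \<in> Q" by (rule ideal.I_l_closed[OF Q(1) q(1) x(1)])
  moreover have "x \<otimes> q \<in> E" if "E \<in> D" for E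
    using insert.prems[of E] that x qc by (intro ideal.I_r_closed) auto
  moreover have "x \<otimes> q \<notin> P" using primeideal.I_prime[OF P x(1) qc] x q by blast
  ultimately show ?case using x qc by (intro bexI[of _ "x \<otimes> q"]) auto
qed

text \<open>
  The hypothesis on \<open>s\<close> says that \<open>J\<close> and \<open>P\<close> have the same localisation at \<open>P\<close>. This localisation
  determines the \<open>P\<close>-primary component of \<open>J\<close>.
\<close>

lemma (in cring) component_of_generically_reduced:
  assumes J: "ideal J R" and P: "primeideal P R" and rad: "P = radical R J"
    and s: "s \<in> carrier R" "s \<notin> P" "\<And>x. x \<in> P \<Longrightarrow> s \<otimes> x \<in> J"
    and D: "minimal_primary_decomposition R J D"
  shows "{Q \<in> D. radical R Q = P} = {P}"
proof -
  have prim: "\<And>Q. Q \<in> D \<Longrightarrow> primary_ideal R Q" and fin: "finite D" and J_eq: "carrier R \<inter> \<Inter>D = J"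
    using D by (auto simp: minimal_primary_decomposition_def)
  have id: "ideal Q R" if "Q \<in> D" for Q using prim[OF that] by (simp add: primary_ideal_def)
  have unique: "Q = P" if Q: "Q \<in> D" "radical R Q = P" for Q
  proof
    show "Q \<subseteq> P" using ideal_subset_radical[OF id[OF Q(1)]] Q(2) by simp
    show "P \<subseteq> Q"
    proof
      fix x assume x: "x \<in> P"
      then have xc: "x \<in> carrier R" unfolding rad radical_def by blast
      have "x \<otimes> s \<in> Q" using s(3)[OF x] J_eq Q(1) m_comm[OF xc s(1)] by auto
      then show "x \<in> Q" using prim[OF Q(1)] xc s(1,2) Q(2) unfolding primary_ideal_def by blast
    qed
  qed
  have "\<exists>Q\<in>D. Q \<subseteq> P"
  proof (rule ccontr)
    assume "\<not> (\<exists>Q\<in>D. Q \<subseteq> P)"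
    with Inter_not_subset_prime[OF P fin] id have "\<exists>x\<in>carrier R \<inter> \<Inter>D. x \<notin> P" by blast
    then show False using ideal_subset_radical[OF J] unfolding J_eq rad by blast
  qed
  then obtain Q where Q: "Q \<in> D" "Q \<subseteq> P" by blast
  have "radical R Q \<subseteq> P" by (rule radical_subset_prime[OF P Q(2)])
  moreover have "P \<subseteq> radical R Q" unfolding rad radical_def using J_eq Q(1) by blast
  ultimately have "radical R Q = P" by simp
  then have "P \<in> D" "radical R P = P" using unique[OF Q(1)] Q(1) by auto
  then show ?thesis using unique by auto
qed

section \<open>Ideals of polynomial rings\<close>

lemma poly_ring_closed:
  fixes p q :: "'a::comm_ring_1 mpolynomial"
  shows poly_ring_zero_closed: "0 \<in> carrier (poly_ring V :: 'a mpolynomial ring)"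
    and poly_ring_one_closed: "1 \<in> carrier (poly_ring V :: 'a mpolynomial ring)"
    and poly_ring_add_closed: "\<lbrakk>p \<in> carrier (poly_ring V); q \<in> carrier (poly_ring V)\<rbrakk> \<Longrightarrow> p + q \<in> carrier (poly_ring V)"
    and poly_ring_mult_closed: "\<lbrakk>p \<in> carrier (poly_ring V); q \<in> carrier (poly_ring V)\<rbrakk> \<Longrightarrow> p * q \<in> carrier (poly_ring V)"
    and poly_ring_uminus_closed: "p \<in> carrier (poly_ring V) \<Longrightarrow> - p \<in> carrier (poly_ring V)"
    and poly_ring_diff_closed: "\<lbrakk>p \<in> carrier (poly_ring V); q \<in> carrier (poly_ring V)\<rbrakk> \<Longrightarrow> p - q \<in> carrier (poly_ring V)"
proof -
  interpret cring "poly_ring V :: 'a mpolynomial ring" by (rule poly_ring_cring)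
  show "0 \<in> carrier (poly_ring V :: 'a mpolynomial ring)" using zero_closed by simp
  show "1 \<in> carrier (poly_ring V :: 'a mpolynomial ring)" using one_closed by simp
  show add: "\<lbrakk>p \<in> carrier (poly_ring V); q \<in> carrier (poly_ring V)\<rbrakk> \<Longrightarrow> p + q \<in> carrier (poly_ring V)"
    for p q :: "'a mpolynomial" using a_closed by simp
  show "\<lbrakk>p \<in> carrier (poly_ring V); q \<in> carrier (poly_ring V)\<rbrakk> \<Longrightarrow> p * q \<in> carrier (poly_ring V)"
    using m_closed by simp
  show um: "p \<in> carrier (poly_ring V) \<Longrightarrow> - p \<in> carrier (poly_ring V)" for p :: "'a mpolynomial"
    by (simp add: mem_carrier_poly_ring)
  show "\<lbrakk>p \<in> carrier (poly_ring V); q \<in> carrier (poly_ring V)\<rbrakk> \<Longrightarrow> p - q \<in> carrier (poly_ring V)"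
    using add[of p "- q"] um[of q] by simp
qed

lemma poly_ring_sum_closed:
  "(\<And>x. x \<in> S \<Longrightarrow> g x \<in> carrier (poly_ring V)) \<Longrightarrow> sum g S \<in> carrier (poly_ring V)"
  by (induction S rule: infinite_finite_induct) (auto intro: poly_ring_closed)

lemma poly_ring_prod_closed:
  "(\<And>x. x \<in> S \<Longrightarrow> g x \<in> carrier (poly_ring V)) \<Longrightarrow> prod g S \<in> carrier (poly_ring V)"
  by (induction S rule: infinite_finite_induct) (auto intro: poly_ring_closed)

lemma poly_ring_power_closed:
  "p \<in> carrier (poly_ring V) \<Longrightarrow> p ^ n \<in> carrier (poly_ring V)"
  by (induction n) (auto intro: poly_ring_closed)

lemma poly_ring_single_closed:
  "Poly_Mapping.keys m \<subseteq> V \<Longrightarrow> Poly_Mapping.single m c \<in> carrier (poly_ring V)"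
  by (auto simp: mem_carrier_poly_ring)

lemma Var_closed: "i \<in> V \<Longrightarrow> Var i \<in> carrier (poly_ring V)"
  unfolding Var_def by (rule poly_ring_single_closed) auto

lemma poly_ring_of_nat_closed: "of_nat n \<in> carrier (poly_ring V :: 'a::comm_ring_1 mpolynomial ring)"
  by (induction n) (auto intro: poly_ring_closed)

lemma poly_ring_nat_pow:
  "x [^]\<^bsub>poly_ring V\<^esub> (n::nat) = x ^ n"
  by (induction n) (simp_all add: nat_pow_def mult.commute)

lemma poly_ring_idealI:
  fixes I :: "'a::comm_ring_1 mpolynomial set"
  assumes sub: "I \<subseteq> carrier (poly_ring V)" and z: "0 \<in> I"
    and add: "\<And>p q. \<lbrakk>p \<in> I; q \<in> I\<rbrakk> \<Longrightarrow> p + q \<in> I"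
    and mult: "\<And>c p. \<lbrakk>c \<in> carrier (poly_ring V); p \<in> I\<rbrakk> \<Longrightarrow> c * p \<in> I"
  shows "ideal I (poly_ring V)"
proof -
  interpret cring "poly_ring V :: 'a mpolynomial ring" by (rule poly_ring_cring)
  have um: "- p \<in> I" if "p \<in> I" for p
    using mult[of "-1" p] that by (simp add: poly_ring_closed)
  have neg: "\<ominus>\<^bsub>poly_ring V\<^esub> p = - p" if "p \<in> I" for p
    using minus_equality[of "- p" p] um that sub by auto
  show ?thesis
  proof (rule idealI[OF ring_axioms])
    show "subgroup I (add_monoid (poly_ring V))"
      using sub z add by (intro add.subgroupI) (auto simp: um neg)
    next
    fix p c :: "'a mpolynomial" assume "p \<in> I" "c \<in> carrier (poly_ring V)"
    then show "c \<otimes>\<^bsub>poly_ring V\<^esub> p \<in> I" "p \<otimes>\<^bsub>poly_ring V\<^esub> c \<in> I"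
      using mult[of c p] by (simp_all add: mult.commute)
  qed
qed

lemma poly_ring_ideal_closed:
  fixes I :: "'a::comm_ring_1 mpolynomial set"
  assumes "ideal I (poly_ring V)"
  shows poly_ring_ideal_zero: "0 \<in> I"
    and poly_ring_ideal_add: "\<lbrakk>p \<in> I; q \<in> I\<rbrakk> \<Longrightarrow> p + q \<in> I"
    and poly_ring_ideal_mult: "\<lbrakk>c \<in> carrier (poly_ring V); p \<in> I\<rbrakk> \<Longrightarrow> c * p \<in> I"
    and poly_ring_ideal_uminus: "p \<in> I \<Longrightarrow> - p \<in> I"
    and poly_ring_ideal_diff: "\<lbrakk>p \<in> I; q \<in> I\<rbrakk> \<Longrightarrow> p - q \<in> I"
    and poly_ring_ideal_sum: "(\<And>x. x \<in> S \<Longrightarrow> g x \<in> I) \<Longrightarrow> sum g S \<in> I"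
    and poly_ring_ideal_carrier: "p \<in> I \<Longrightarrow> p \<in> carrier (poly_ring V)"
proof -
  interpret I: ideal I "poly_ring V" by (rule assms)
  note sub = I.is_additive_subgroup
  show z: "0 \<in> I" using additive_subgroup.zero_closed[OF sub] by simp
  show add: "\<lbrakk>p \<in> I; q \<in> I\<rbrakk> \<Longrightarrow> p + q \<in> I" for p q
    using additive_subgroup.a_closed[OF sub, of p q] by simp
  show mult: "\<lbrakk>c \<in> carrier (poly_ring V); p \<in> I\<rbrakk> \<Longrightarrow> c * p \<in> I" for c p using I.I_l_closed by simp
  show um: "p \<in> I \<Longrightarrow> - p \<in> I" for p
    using mult[of "-1" p] by (simp add: poly_ring_closed)
  show "\<lbrakk>p \<in> I; q \<in> I\<rbrakk> \<Longrightarrow> p - q \<in> I" using add[of p "- q"] um[of q] by simp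
  show "(\<And>x. x \<in> S \<Longrightarrow> g x \<in> I) \<Longrightarrow> sum g S \<in> I"
    by (induction S rule: infinite_finite_induct) (auto intro: z add)
  show "p \<in> I \<Longrightarrow> p \<in> carrier (poly_ring V)" by (rule I.Icarr)
qed

text \<open>
  In the binomial expansion of \<open>(x + y)\<^sup>n\<^sup>+\<^sup>k\<close> every term is divisible by \<open>x\<^sup>n\<close> or by \<open>y\<^sup>k\<close>.
\<close>

lemma ideal_radical:
  fixes J :: "'a::comm_ring_1 mpolynomial set"
  assumes J: "ideal J (poly_ring V)"
  shows "ideal (radical (poly_ring V) J) (poly_ring V)"
proof (rule poly_ring_idealI)
  have mem: "x \<in> radical (poly_ring V) J \<longleftrightarrow> x \<in> carrier (poly_ring V) \<and> (\<exists>n. x ^ n \<in> J)" for x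
    by (simp add: radical_def poly_ring_nat_pow)
  show "radical (poly_ring V) J \<subseteq> carrier (poly_ring V)" by (auto simp: mem)
  have "0 ^ 1 \<in> J" using poly_ring_ideal_zero[OF J] by simp
  then show "0 \<in> radical (poly_ring V) J" unfolding mem using poly_ring_zero_closed by blast
next
  fix c x :: "'a mpolynomial" assume c: "c \<in> carrier (poly_ring V)" and x: "x \<in> radical (poly_ring V) J"
  then obtain n where "x \<in> carrier (poly_ring V)" "x ^ n \<in> J" by (auto simp: radical_def poly_ring_nat_pow)
  moreover from this c have "(c * x) ^ n \<in> J"
    unfolding power_mult_distrib by (intro poly_ring_ideal_mult[OF J] poly_ring_power_closed)
  ultimately show "c * x \<in> radical (poly_ring V) J"
    using c by (auto simp: radical_def poly_ring_nat_pow intro: poly_ring_closed)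
next
  fix x y :: "'a mpolynomial" assume x: "x \<in> radical (poly_ring V) J" and y: "y \<in> radical (poly_ring V) J"
  then obtain n k where xc: "x \<in> carrier (poly_ring V)" "x ^ n \<in> J" and yc: "y \<in> carrier (poly_ring V)" "y ^ k \<in> J"
    by (auto simp: radical_def poly_ring_nat_pow)
  have "of_nat ((n + k) choose i) * x ^ i * y ^ (n + k - i) \<in> J" if i: "i \<le> n + k" for i
  proof (cases "n \<le> i")
    case True
    then have "of_nat ((n + k) choose i) * x ^ i * y ^ (n + k - i)
        = (of_nat ((n + k) choose i) * x ^ (i - n) * y ^ (n + k - i)) * x ^ n"
      using power_add[of x "i - n" n] by (simp add: ac_simps)
    also have "\<dots> \<in> J"
      by (intro poly_ring_ideal_mult[OF J] poly_ring_mult_closed poly_ring_power_closed poly_ring_of_nat_closed xc yc)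
    finally show ?thesis .
  next
    case False
    then have "of_nat ((n + k) choose i) * x ^ i * y ^ (n + k - i)
        = (of_nat ((n + k) choose i) * x ^ i * y ^ (n - i)) * y ^ k"
      using power_add[of y "n - i" k] by (simp add: ac_simps)
    also have "\<dots> \<in> J"
      by (intro poly_ring_ideal_mult[OF J] poly_ring_mult_closed poly_ring_power_closed poly_ring_of_nat_closed xc yc)
    finally show ?thesis .
  qed
  then have "(x + y) ^ (n + k) \<in> J"
    unfolding binomial_ring by (intro poly_ring_ideal_sum[OF J]) auto
  then show "x + y \<in> radical (poly_ring V) J"
    using xc yc by (auto simp: radical_def poly_ring_nat_pow intro: poly_ring_closed)
qed

lemma ideal_colon:
  fixes J :: "'a::comm_ring_1 mpolynomial set"
  assumes J: "ideal J (poly_ring V)"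
  shows "ideal {y \<in> carrier (poly_ring V). d * y \<in> J} (poly_ring V)" (is "ideal ?I _")
proof (rule poly_ring_idealI)
  fix c p :: "'a mpolynomial" assume "c \<in> carrier (poly_ring V)" "p \<in> ?I"
  then show "c * p \<in> ?I"
    using poly_ring_ideal_mult[OF J, of c "d * p"] by (simp add: poly_ring_closed ac_simps)
qed (auto simp: distrib_left poly_ring_closed intro: poly_ring_ideal_closed[OF J])

text \<open>
  Over a field of characteristic zero a positive integer is a unit. This enters through the factor
  in Euler's formula and through the antidiagonals on which cofactors occur in equal pairs.
\<close>

lemma of_nat_cancel_in_ideal:
  fixes I :: "'k::field_char_0 mpolynomial set"
  assumes I: "ideal I (poly_ring V)" and n: "n > 0" and x: "of_nat n * x \<in> I"
  shows "x \<in> I"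
proof -
  have "Poly_Mapping.single 0 (inverse (of_nat n)) * (of_nat n * x) \<in> I"
    by (intro poly_ring_ideal_mult[OF I _ x] poly_ring_single_closed) simp
  also have "Poly_Mapping.single 0 (inverse (of_nat n)) * (of_nat n * x)
      = (Poly_Mapping.single 0 (inverse (of_nat n)) * Poly_Mapping.single 0 (of_nat n)) * x"
    by (simp add: mult.assoc)
  also have "\<dots> = x" unfolding mult_single using n by simp
  finally show ?thesis .
qed

section \<open>Polynomial rings over a field are Noetherian\<close>

lemma lookup_single_mult:
  fixes q :: "'b::cancel_comm_monoid_add \<Rightarrow>\<^sub>0 'a::comm_semiring_1"
  shows "Poly_Mapping.lookup (Poly_Mapping.single d c * q) (d + k) = c * Poly_Mapping.lookup q k"
  by (simp add: lookup_mult lookup_single when_mult)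

text \<open>
  One variable at a time, pass to a subsequence along which its exponent is nondecreasing. In the
  step, repeatedly choose the position of a minimum of the remaining exponents.
\<close>

lemma Dickson_subsequence:
  fixes s :: "nat \<Rightarrow> nat \<Rightarrow>\<^sub>0 nat"
  assumes "finite V"
  shows "\<exists>f :: nat \<Rightarrow> nat. strict_mono f \<and> (\<forall>i j. i \<le> j \<longrightarrow> (\<forall>v\<in>V. Poly_Mapping.lookup (s (f i)) v \<le> Poly_Mapping.lookup (s (f j)) v))"
  using assms
proof (induction V)
  case empty
  show ?case by (rule exI[of _ id]) (simp add: strict_mono_def)
next
  case (insert v V)
  then obtain f :: "nat \<Rightarrow> nat" where f: "strict_mono f"
    "\<And>i j u. \<lbrakk>i \<le> j; u \<in> V\<rbrakk> \<Longrightarrow> Poly_Mapping.lookup (s (f i)) u \<le> Poly_Mapping.lookup (s (f j)) u" by blast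
  define a where "a n = Poly_Mapping.lookup (s (f n)) v" for n
  have "\<exists>g :: nat \<Rightarrow> nat. strict_mono g \<and> (\<forall>i j. i \<le> j \<longrightarrow> a (g i) \<le> a (g j))"
  proof -
    have "\<exists>g :: nat \<Rightarrow> nat. strict_mono g \<and> (\<forall>n. \<forall>m\<ge>g n. a (g n) \<le> a m)"
    proof -
      have "\<exists>k\<ge>l. \<forall>m\<ge>k. a k \<le> a m" for l
      proof -
        have "\<exists>k. l \<le> k \<and> (\<forall>y. l \<le> y \<longrightarrow> a k \<le> a y)"
          by (rule ex_has_least_nat[of "\<lambda>k. l \<le> k" l a]) simp
        then show ?thesis by (meson le_trans)
      qed
      then have "\<forall>l. \<exists>k>l. \<forall>m\<ge>k. a k \<le> a m" by (meson Suc_le_eq)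
      then have "\<exists>g. \<forall>n. (\<forall>m\<ge>g n. a (g n) \<le> a m) \<and> g n < g (Suc n)"
        by (intro dependent_nat_choice) blast+
      then show ?thesis by (auto simp: strict_mono_Suc_iff)
    qed
    then show ?thesis by (metis strict_mono_less_eq)
  qed
  then obtain g :: "nat \<Rightarrow> nat" where g: "strict_mono g" "\<And>i j. i \<le> j \<Longrightarrow> a (g i) \<le> a (g j)" by blast
  have "strict_mono (f \<circ> g)" using f g by (simp add: strict_mono_o)
  moreover have "Poly_Mapping.lookup (s ((f \<circ> g) i)) u \<le> Poly_Mapping.lookup (s ((f \<circ> g) j)) u"
    if "i \<le> j" "u \<in> insert v V" for i j u
    using that g(2)[OF that(1)] f(2)[of "g i" "g j" u] g(1) by (auto simp: a_def strict_mono_less_eq)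
  ultimately show ?case by blast
qed

lemma Dickson:
  fixes s :: "nat \<Rightarrow> nat \<Rightarrow>\<^sub>0 nat"
  assumes "finite V" "\<And>n. Poly_Mapping.keys (s n) \<subseteq> V"
  shows "\<exists>i j d. i < j \<and> s j = s i + d"
proof -
  obtain f :: "nat \<Rightarrow> nat" where f: "strict_mono f"
    "\<And>i j v. \<lbrakk>i \<le> j; v \<in> V\<rbrakk> \<Longrightarrow> Poly_Mapping.lookup (s (f i)) v \<le> Poly_Mapping.lookup (s (f j)) v"
    using Dickson_subsequence[OF assms(1), of s] by blast
  have "Poly_Mapping.lookup (s (f 0)) v \<le> Poly_Mapping.lookup (s (f 1)) v" for v
  proof (cases "v \<in> V")
    case False
    then have "Poly_Mapping.lookup (s (f 0)) v = 0" using assms(2)[of "f 0"] by (auto simp: in_keys_iff)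
    then show ?thesis by simp
  qed (simp add: f)
  then have "s (f 1) = s (f 0) + (s (f 1) - s (f 0))"
    by (intro poly_mapping_eqI) (simp add: lookup_add lookup_minus)
  moreover have "f 0 < f 1" using f(1) by (simp add: strict_mono_less)
  ultimately show ?thesis by blast
qed

lemma monomial_zero_le: "(0 :: nat \<Rightarrow>\<^sub>0 nat) \<le> d"
proof -
  have "\<not> d < 0" by transfer (simp add: less_fun_def)
  then show ?thesis by simp
qed

lemma monomial_order_wf:
  assumes "finite V"
  shows "wf {(a :: nat \<Rightarrow>\<^sub>0 nat, b). Poly_Mapping.keys a \<subseteq> V \<and> Poly_Mapping.keys b \<subseteq> V \<and> a < b}"
  unfolding wf_iff_no_infinite_down_chain
proof
  assume "\<exists>s. \<forall>i. (s (Suc i), s i) \<in> {(a :: nat \<Rightarrow>\<^sub>0 nat, b). Poly_Mapping.keys a \<subseteq> V \<and> Poly_Mapping.keys b \<subseteq> V \<and> a < b}"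
  then obtain s :: "nat \<Rightarrow> nat \<Rightarrow>\<^sub>0 nat" where s: "\<And>i. Poly_Mapping.keys (s i) \<subseteq> V" "\<And>i. s (Suc i) < s i" by blast
  from Dickson[OF assms s(1)] obtain i j d where ij: "i < j" "s j = s i + d" by blast
  have "s j < s i" using ij(1)
    by (induction j) (use s(2) in \<open>auto simp: less_Suc_eq intro: less_trans\<close>)
  moreover have "s i \<le> s i + d" using add_left_mono[OF monomial_zero_le, of "s i" d] by simp
  ultimately show False using ij by simp
qed

text \<open>
  The leading monomial for the lexicographic order that the type of monomials carries; its value at
  the zero polynomial is unspecified.
\<close>

definition lead_monom :: "'a::zero mpolynomial \<Rightarrow> nat \<Rightarrow>\<^sub>0 nat" where
  "lead_monom p = Max (Poly_Mapping.keys p)"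

lemma lead_monom_in_keys: "p \<noteq> 0 \<Longrightarrow> lead_monom p \<in> Poly_Mapping.keys p"
  unfolding lead_monom_def by (rule Max_in) auto

lemma lead_monom_reduce:
  fixes p q :: "'k::field mpolynomial"
  assumes p: "p \<noteq> 0" and q: "q \<noteq> 0" and d: "lead_monom p = lead_monom q + d"
  obtains c where "p - Poly_Mapping.single d c * q = 0 \<or> lead_monom (p - Poly_Mapping.single d c * q) < lead_monom p"
proof -
  define c where "c = Poly_Mapping.lookup p (lead_monom p) / Poly_Mapping.lookup q (lead_monom q)"
  let ?h = "p - Poly_Mapping.single d c * q"
  have "Poly_Mapping.lookup q (lead_monom q) \<noteq> 0"
    using lead_monom_in_keys[OF q] by (simp add: in_keys_iff)
  then have "c * Poly_Mapping.lookup q (lead_monom q) = Poly_Mapping.lookup p (lead_monom p)"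
    by (simp add: c_def)
  moreover have "Poly_Mapping.lookup (Poly_Mapping.single d c * q) (lead_monom p)
      = c * Poly_Mapping.lookup q (lead_monom q)"
    unfolding d add.commute[of _ d] by (rule lookup_single_mult)
  ultimately have "Poly_Mapping.lookup ?h (lead_monom p) = 0" by (simp add: lookup_minus)
  then have top: "lead_monom p \<notin> Poly_Mapping.keys ?h" by (simp add: in_keys_iff)
  have le: "k \<le> lead_monom p" if k: "k \<in> Poly_Mapping.keys ?h" for k
  proof -
    have "k \<in> Poly_Mapping.keys p \<or> k \<in> Poly_Mapping.keys (Poly_Mapping.single d c * q)"
      using subsetD[OF Poly_Mapping.keys_diff k] by blast
    then show ?thesis
    proof
      assume "k \<in> Poly_Mapping.keys p" then show ?thesis by (simp add: lead_monom_def)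
    next
      assume "k \<in> Poly_Mapping.keys (Poly_Mapping.single d c * q)"
      from subsetD[OF keys_mult this] obtain a l where
        a: "a \<in> Poly_Mapping.keys (Poly_Mapping.single d c)" and
        l: "l \<in> Poly_Mapping.keys q" "k = a + l" by blast
      from a have "a = d" by (simp split: if_splits)
      from l have "l \<le> lead_monom q" by (simp add: lead_monom_def)
      then show ?thesis using l d \<open>a = d\<close> by (simp add: add.commute add_left_mono)
    qed
  qed
  have "?h = 0 \<or> lead_monom ?h < lead_monom p"
  proof (cases "?h = 0")
    case False
    then have "lead_monom ?h \<in> Poly_Mapping.keys ?h" by (rule lead_monom_in_keys)
    with le top show ?thesis by (metis order.not_eq_order_implies_strict)
  qed simp
  then show thesis by (rule that)
qed

text \<open>
  Suppose an ideal is not finitely generated. Choose elements \<open>g n\<close> of it one after the other,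
  each outside the ideal generated by the previous ones and with least possible leading monomial.
  By Dickson's lemma the leading monomial of some \<open>g j\<close> is divisible by that of an earlier \<open>g i\<close>.
  Subtracting a multiple of \<open>g i\<close> from \<open>g j\<close> yields a smaller leading monomial, contradicting
  the choice of \<open>g j\<close>.
\<close>

theorem poly_ring_noetherian:
  assumes V: "finite V"
  shows "noetherian_cring (poly_ring V :: 'k::field mpolynomial ring)"
proof -
  let ?R = "poly_ring V :: 'k mpolynomial ring"
  interpret cring ?R by (rule poly_ring_cring)
  have "\<exists>A\<subseteq>carrier ?R. finite A \<and> I = Idl\<^bsub>?R\<^esub> A" if I: "ideal I ?R" for I
  proof (rule ccontr)
    assume nfg: "\<not> (\<exists>A\<subseteq>carrier ?R. finite A \<and> I = Idl\<^bsub>?R\<^esub> A)"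
    have Ic: "I \<subseteq> carrier ?R" using poly_ring_ideal_carrier[OF I] by blast
    define next_gen where "next_gen A p \<longleftrightarrow> p \<in> I - Idl\<^bsub>?R\<^esub> A \<and>
      (\<forall>q \<in> I - Idl\<^bsub>?R\<^esub> A. \<not> lead_monom q < lead_monom p)" for A p
    have next_ex: "\<exists>p. next_gen A p" if A: "finite A" "A \<subseteq> I" for A
    proof -
      have AC: "A \<subseteq> carrier ?R" using A Ic by blast
      have "Idl\<^bsub>?R\<^esub> A \<subseteq> I" by (rule genideal_minimal[OF I A(2)])
      with nfg A AC obtain p where p: "p \<in> I - Idl\<^bsub>?R\<^esub> A" by blast
      have nz: "q \<noteq> 0" if "q \<in> I - Idl\<^bsub>?R\<^esub> A" for q
        using that poly_ring_ideal_zero[OF genideal_ideal[OF AC]] by auto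
      have keysV: "Poly_Mapping.keys (lead_monom q) \<subseteq> V" if "q \<in> I - Idl\<^bsub>?R\<^esub> A" for q
        using lead_monom_in_keys[OF nz[OF that]] poly_ring_ideal_carrier[OF I, of q] that
        by (simp add: mem_carrier_poly_ring)
      have "lead_monom p \<in> lead_monom ` (I - Idl\<^bsub>?R\<^esub> A)" using p by blast
      then obtain z where z: "z \<in> lead_monom ` (I - Idl\<^bsub>?R\<^esub> A)"
        "\<And>y. (y, z) \<in> {(a, b). Poly_Mapping.keys a \<subseteq> V \<and> Poly_Mapping.keys b \<subseteq> V \<and> a < b} \<Longrightarrow> y \<notin> lead_monom ` (I - Idl\<^bsub>?R\<^esub> A)"
        by (rule wfE_min[OF monomial_order_wf[OF V]]) (rule that)
      then obtain p' where p': "p' \<in> I - Idl\<^bsub>?R\<^esub> A" "z = lead_monom p'" by blast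
      have "\<not> lead_monom q < lead_monom p'" if "q \<in> I - Idl\<^bsub>?R\<^esub> A" for q
        using z(2)[of "lead_monom q"] keysV[OF that] keysV[OF p'(1)] that p'(2) by blast
      with p' show ?thesis unfolding next_gen_def by blast
    qed
    have "\<exists>g. \<forall>n::nat. next_gen (g ` {..<n}) (g n)"
    proof (rule dependent_wellorder_choice)
      fix r and f g :: "nat \<Rightarrow> 'k mpolynomial" and n :: nat
      assume "\<And>i. i < n \<Longrightarrow> f i = g i"
      then have "f ` {..<n} = g ` {..<n}" by (intro image_cong) auto
      then show "next_gen (f ` {..<n}) r = next_gen (g ` {..<n}) r" by simp
    next
      fix n :: nat and f :: "nat \<Rightarrow> 'k mpolynomial"
      assume "\<And>i. i < n \<Longrightarrow> next_gen (f ` {..<i}) (f i)"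
      then show "\<exists>r. next_gen (f ` {..<n}) r" by (intro next_ex) (auto simp: next_gen_def)
    qed
    then obtain g where g: "\<And>n::nat. next_gen (g ` {..<n}) (g n)" by blast
    have gI: "g n \<in> I" for n using g[of n] by (simp add: next_gen_def)
    have gen: "ideal (Idl\<^bsub>?R\<^esub> (g ` {..<n})) ?R" "g ` {..<n} \<subseteq> Idl\<^bsub>?R\<^esub> (g ` {..<n})" for n
      using gI Ic by (auto intro!: genideal_ideal genideal_self)
    have gnz: "g n \<noteq> 0" for n
      using g[of n] poly_ring_ideal_zero[OF gen(1)[of n]] by (auto simp: next_gen_def)
    have keysV: "Poly_Mapping.keys (lead_monom (g n)) \<subseteq> V" for n
      using lead_monom_in_keys[OF gnz, of n] poly_ring_ideal_carrier[OF I gI, of n]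
      by (simp add: mem_carrier_poly_ring)
    from Dickson[OF V keysV] obtain i j d where ij: "i < j"
      "lead_monom (g j) = lead_monom (g i) + d" by blast
    from lead_monom_reduce[OF gnz gnz ij(2)] obtain c where
      c: "g j - Poly_Mapping.single d c * g i = 0 \<or>
          lead_monom (g j - Poly_Mapping.single d c * g i) < lead_monom (g j)" .
    let ?h = "g j - Poly_Mapping.single d c * g i"
    have "Poly_Mapping.keys d \<subseteq> Poly_Mapping.keys (lead_monom (g j))"
      unfolding ij(2) by (auto simp: in_keys_iff lookup_add)
    then have sC: "Poly_Mapping.single d c \<in> carrier ?R"
      using keysV[of j] by (intro poly_ring_single_closed) blast
    have red: "Poly_Mapping.single d c * g i \<in> Idl\<^bsub>?R\<^esub> (g ` {..<j})"
      using gen(2)[of j] ij(1) by (intro poly_ring_ideal_mult[OF gen(1) sC]) blast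
    have "?h \<notin> Idl\<^bsub>?R\<^esub> (g ` {..<j})"
      using poly_ring_ideal_add[OF gen(1) _ red, of ?h] g[of j] by (auto simp: next_gen_def)
    moreover have "?h \<in> I" using gI by (intro poly_ring_ideal_diff[OF I] poly_ring_ideal_mult[OF I sC])
    ultimately have "?h \<in> I - Idl\<^bsub>?R\<^esub> (g ` {..<j})" by blast
    with g[of j] c have "?h = 0" by (auto simp: next_gen_def)
    with \<open>?h \<notin> _\<close> poly_ring_ideal_zero[OF gen(1)] show False by simp
  qed
  then have "noetherian_ring ?R" by (rule noetherian_ringI)
  then show ?thesis by (simp add: noetherian_cring_def cring_axioms)
qed

section \<open>Determinants and submaximal minors\<close>

lemma det_replace_col:
  assumes A: "A \<in> carrier_mat n n" and k: "k < n"
  shows "det (replace_col A v k) = (\<Sum>i<n. v $ i * cofactor A i k)"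
proof -
  have R: "replace_col A v k \<in> carrier_mat n n" using A by (simp add: replace_col_def)
  have del: "mat_delete (replace_col A v k) i k = mat_delete A i k" for i
    using A by (intro eq_matI) (auto simp: mat_delete_def replace_col_def)
  show ?thesis
    unfolding laplace_expansion_column[OF R k] cofactor_def del
    using A k by (intro sum.cong) (auto simp: replace_col_def)
qed

lemma cofactor_orthogonal_rows:
  assumes A: "A \<in> carrier_mat n n" and ij: "i < n" "j < n"
  shows "(\<Sum>k<n. A $$ (i,k) * cofactor A j k) = (if i = j then det A else 0)"
proof -
  have "(\<Sum>k<n. A $$ (i,k) * cofactor A j k) = (A * adj_mat A) $$ (i,j)"
    unfolding times_mat_def scalar_prod_def adj_mat_def using ij A
    by (auto intro!: sum.cong simp: atLeast0LessThan)
  then show ?thesis using adj_mat(2)[OF A] ij by simp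
qed

lemma cofactor_orthogonal_cols:
  assumes A: "A \<in> carrier_mat n n" and ij: "i < n" "j < n"
  shows "(\<Sum>k<n. A $$ (k,j) * cofactor A k i) = (if i = j then det A else 0)"
proof -
  have "(\<Sum>k<n. A $$ (k,j) * cofactor A k i) = (adj_mat A * A) $$ (i,j)"
    unfolding times_mat_def scalar_prod_def adj_mat_def using ij A
    by (auto intro!: sum.cong simp: atLeast0LessThan mult.commute)
  then show ?thesis using adj_mat(3)[OF A] ij by simp
qed

lemma cofactor_symmetric:
  assumes A: "A \<in> carrier_mat n n" and sym: "\<And>i j. \<lbrakk>i < n; j < n\<rbrakk> \<Longrightarrow> A $$ (i,j) = A $$ (j,i)"
    and ij: "i < n" "j < n"
  shows "cofactor A i j = cofactor A j i"
proof -
  have "mat_delete A j i = transpose_mat (mat_delete A i j)"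
    using A ij by (intro eq_matI) (auto simp: mat_delete_def sym)
  moreover have "mat_delete A i j \<in> carrier_mat (n - 1) (n - 1)" using A by (rule mat_delete_carrier)
  ultimately show ?thesis unfolding cofactor_def by (simp add: det_transpose add.commute)
qed

text \<open>
  This is Jacobi's identity for a principal 2-by-2 minor of the adjugate, kept in a form that needs
  no division by the determinant: the second factor on the right is again a cofactor, of a matrix
  with entries taken from \<open>A\<close>, 0 and 1. The proof applies Cramer's rule to the matrix \<open>B\<close> obtained
  from \<open>A\<close> by replacing column \<open>a\<close> with a unit vector, and to the vector of cofactors of row \<open>b\<close>,
  which \<open>A\<close> maps to a multiple of a unit vector.
\<close>

lemma principal_cofactor_minor:
  fixes A :: "'a::comm_ring_1 mat"
  assumes A: "A \<in> carrier_mat n n" and ab: "a < n" "b < n" "a \<noteq> b"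
  shows "\<exists>B\<in>carrier_mat n n. (\<forall>i<n. \<forall>j<n. B $$ (i,j) \<in> {0, 1, A $$ (i,j)}) \<and>
    cofactor A a a * cofactor A b b - cofactor A a b * cofactor A b a = det A * cofactor B b b"
proof -
  define B where "B = replace_col A (unit_vec n a) a"
  have B: "B \<in> carrier_mat n n" using A by (simp add: B_def replace_col_def)
  have Bij: "B $$ (i,j) = (if j = a then (if i = a then 1 else 0) else A $$ (i,j))" if "i < n" "j < n" for i j
    using that A by (simp add: B_def replace_col_def)
  have unit: "(\<Sum>i<n. unit_vec n c $ i * g i) = g c" if "c < n" for c and g :: "nat \<Rightarrow> 'a"
  proof -
    have "(\<Sum>i<n. unit_vec n c $ i * g i) = (\<Sum>i<n. if i = c then g i else 0)"
      by (intro sum.cong) (auto simp: unit_vec_def)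
    then show ?thesis using that by simp
  qed
  have detB: "det B = cofactor A a a" unfolding B_def det_replace_col[OF A ab(1)] by (rule unit[OF ab(1)])
  define x where "x = vec n (cofactor A b)"
  have x: "x \<in> carrier_vec n" by (simp add: x_def)
  have Bx: "(B *\<^sub>v x) $ i = (if i = b then det A else 0) - A $$ (i,a) * cofactor A b a
      + (if i = a then cofactor A b a else 0)" if i: "i < n" for i
  proof -
    have "(B *\<^sub>v x) $ i = (\<Sum>j<n. B $$ (i,j) * cofactor A b j)"
      using i B by (auto simp: x_def scalar_prod_def atLeast0LessThan intro!: sum.cong)
    also have "\<dots> = B $$ (i,a) * cofactor A b a + (\<Sum>j\<in>{..<n} - {a}. B $$ (i,j) * cofactor A b j)"
      using ab by (subst sum.remove[of _ a]) auto
    also have "(\<Sum>j\<in>{..<n} - {a}. B $$ (i,j) * cofactor A b j)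
        = (\<Sum>j\<in>{..<n} - {a}. A $$ (i,j) * cofactor A b j)"
      using i by (intro sum.cong) (auto simp: Bij)
    also have "\<dots> = (\<Sum>j<n. A $$ (i,j) * cofactor A b j) - A $$ (i,a) * cofactor A b a"
      using ab by (subst sum.remove[of "{..<n}" a]) auto
    also have "(\<Sum>j<n. A $$ (i,j) * cofactor A b j) = (if i = b then det A else 0)"
      by (rule cofactor_orthogonal_rows[OF A i ab(2)])
    finally show ?thesis using i ab by (simp add: Bij)
  qed
  \<comment> \<open>Expanding a determinant with equal columns \<open>a\<close> and \<open>b\<close>, both unit vectors, leaves this cofactor.\<close>
  have zero: "cofactor B a b = 0"
  proof -
    have "(\<Sum>k<n. B $$ (k,a) * cofactor B k b) = (\<Sum>k<n. if k = a then cofactor B k b else 0)"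
      using ab by (intro sum.cong) (auto simp: Bij)
    then show ?thesis using cofactor_orthogonal_cols[OF B ab(2) ab(1)] ab by simp
  qed
  \<comment> \<open>Up to exchanging columns \<open>a\<close> and \<open>b\<close>, this is \<open>A\<close> with a unit vector in column \<open>b\<close>.\<close>
  let ?S = "replace_col B (col A a) b"
  have S: "?S \<in> carrier_mat n n" using B by (simp add: replace_col_def)
  have swap: "(\<Sum>i<n. A $$ (i,a) * cofactor B i b) = - cofactor A a b"
  proof -
    have "(\<Sum>i<n. A $$ (i,a) * cofactor B i b) = det ?S"
      unfolding det_replace_col[OF B ab(2)] using A ab by (intro sum.cong) auto
    also have "\<dots> = - det (swapcols a b ?S)" using det_swapcols[OF ab S] by simp
    also have "swapcols a b ?S = replace_col A (unit_vec n a) b"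
      using A B ab by (intro eq_matI) (auto simp: replace_col_def mat_swapcols_def Bij)
    also have "det \<dots> = cofactor A a b"
      unfolding det_replace_col[OF A ab(2)] by (rule unit[OF ab(1)])
    finally show ?thesis .
  qed
  have "cofactor A b b * cofactor A a a = det (replace_col B (B *\<^sub>v x) b)"
    using cramer_lemma_mat[OF B x ab(2)] detB ab by (simp add: x_def)
  also have "\<dots> = (\<Sum>i<n. (if i = b then det A * cofactor B b b else 0)
      - cofactor A b a * (A $$ (i,a) * cofactor B i b) + (if i = a then cofactor A b a * cofactor B a b else 0))"
    unfolding det_replace_col[OF B ab(2)] by (intro sum.cong) (auto simp: Bx algebra_simps)
  also have "\<dots> = det A * cofactor B b b - cofactor A b a * (\<Sum>i<n. A $$ (i,a) * cofactor B i b)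
      + cofactor A b a * cofactor B a b"
    using ab by (simp add: sum.distrib sum_subtractf sum_distrib_left)
  also have "\<dots> = det A * cofactor B b b + cofactor A b a * cofactor A a b"
    unfolding swap zero by simp
  finally have "cofactor A a a * cofactor A b b - cofactor A a b * cofactor A b a = det A * cofactor B b b"
    by (simp add: algebra_simps)
  moreover have "\<forall>i<n. \<forall>j<n. B $$ (i,j) \<in> {0, 1, A $$ (i,j)}" by (auto simp: Bij)
  ultimately show ?thesis using B by blast
qed

text \<open>
  By the product rule, the derivative is the sum over all rows \<open>a\<close> of the determinant in which \<open>D\<close>
  has been applied to row \<open>a\<close>; expand this determinant along that row.
\<close>

lemma det_derivation:
  fixes D :: "'a::comm_ring_1 \<Rightarrow> 'a"
  assumes add: "\<And>x y. D (x + y) = D x + D y" and mult: "\<And>x y. D (x * y) = D x * y + x * D y"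
    and A: "A \<in> carrier_mat n n"
  shows "D (det A) = (\<Sum>a<n. \<Sum>b<n. D (A $$ (a,b)) * cofactor A a b)"
proof -
  have D0: "D 0 = 0" using add[of 0 0] by simp
  have D1: "D 1 = 0" using mult[of 1 1] by simp
  have Dneg: "D (- x) = - D x" for x
    using add[of x "- x"] D0 by (simp add: eq_neg_iff_add_eq_0 add.commute)
  have Dsum: "D (sum g S) = (\<Sum>x\<in>S. D (g x))" for g :: "(nat \<Rightarrow> nat) \<Rightarrow> 'a" and S
    by (induction S rule: infinite_finite_induct) (auto simp: add D0)
  have Dprod: "D (prod g S) = (\<Sum>x\<in>S. D (g x) * prod g (S - {x}))" if "finite S"
    for g :: "nat \<Rightarrow> 'a" and S
    using that
  proof (induction S)
    case (insert y S)
    have "(\<Sum>x\<in>S. D (g x) * prod g (insert y S - {x})) = (\<Sum>x\<in>S. g y * (D (g x) * prod g (S - {x})))"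
    proof (intro sum.cong refl)
      fix x assume "x \<in> S"
      then have "insert y S - {x} = insert y (S - {x})" "y \<notin> S - {x}" using insert by auto
      then show "D (g x) * prod g (insert y S - {x}) = g y * (D (g x) * prod g (S - {x}))"
        using insert by (simp add: ac_simps)
    qed
    then show ?case using insert by (simp add: mult sum_distrib_left)
  qed (simp add: D1)
  have Dsign: "D (signof p * x) = signof p * D x" for p and x :: 'a
    by (simp add: sign_def Dneg)
  let ?Pm = "{p. p permutes {0..<n}}"
  let ?R = "\<lambda>a. mat n n (\<lambda>(i,j). if i = a then D (A $$ (a,j)) else A $$ (i,j))"
  have detR: "det (?R a) = (\<Sum>p\<in>?Pm. signof p * (D (A $$ (a, p a)) * (\<Prod>i\<in>{0..<n} - {a}. A $$ (i, p i))))"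
    if a: "a < n" for a
  proof -
    have "(\<Prod>i=0..<n. ?R a $$ (i, p i)) = D (A $$ (a, p a)) * (\<Prod>i\<in>{0..<n} - {a}. A $$ (i, p i))"
      if p: "p permutes {0..<n}" for p
    proof -
      have pn: "p i < n" if "i < n" for i using permutes_in_image[OF p, of i] that by simp
      have "(\<Prod>i=0..<n. ?R a $$ (i, p i)) = ?R a $$ (a, p a) * (\<Prod>i\<in>{0..<n} - {a}. ?R a $$ (i, p i))"
        using a by (intro prod.remove) auto
      also have "(\<Prod>i\<in>{0..<n} - {a}. ?R a $$ (i, p i)) = (\<Prod>i\<in>{0..<n} - {a}. A $$ (i, p i))"
        using pn by (intro prod.cong) auto
      finally show ?thesis using a pn by simp
    qed
    then show ?thesis by (subst det_def'[of _ n]) (auto intro!: sum.cong)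
  qed
  have expand: "det (?R a) = (\<Sum>b<n. D (A $$ (a,b)) * cofactor A a b)" if a: "a < n" for a
  proof -
    have "mat_delete (?R a) a b = mat_delete A a b" for b
      using A by (intro eq_matI) (auto simp: mat_delete_def)
    then show ?thesis
      using a by (subst laplace_expansion_row[of _ n a]) (auto simp: cofactor_def intro!: sum.cong)
  qed
  have "D (det A) = (\<Sum>p\<in>?Pm. \<Sum>a<n. signof p * (D (A $$ (a, p a)) * (\<Prod>i\<in>{0..<n} - {a}. A $$ (i, p i))))"
    unfolding det_def'[OF A] Dsum Dsign by (simp add: Dprod sum_distrib_left atLeast0LessThan)
  also have "\<dots> = (\<Sum>a<n. det (?R a))"
    by (subst sum.swap) (auto intro!: sum.cong simp: detR)
  finally show ?thesis by (simp add: expand)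
qed

lemma det_closed:
  fixes A :: "'a::comm_ring_1 mpolynomial mat"
  assumes A: "A \<in> carrier_mat n n" and ent: "\<And>i j. \<lbrakk>i < n; j < n\<rbrakk> \<Longrightarrow> A $$ (i,j) \<in> carrier (poly_ring V)"
  shows "det A \<in> carrier (poly_ring V)"
  unfolding det_def'[OF A]
proof (intro poly_ring_sum_closed poly_ring_mult_closed poly_ring_prod_closed)
  fix p assume "p \<in> {p. p permutes {0..<n}}"
  then have p: "p permutes {0..<n}" by simp
  show "signof p \<in> carrier (poly_ring V :: 'a mpolynomial ring)"
    by (simp add: sign_def poly_ring_closed)
  fix i assume "i \<in> {0..<n}"
  then show "A $$ (i, p i) \<in> carrier (poly_ring V)" using permutes_in_image[OF p, of i] by (intro ent) auto
qed

lemma cofactor_closed: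
  fixes A :: "'a::comm_ring_1 mpolynomial mat"
  assumes A: "A \<in> carrier_mat n n" and ent: "\<And>i j. \<lbrakk>i < n; j < n\<rbrakk> \<Longrightarrow> A $$ (i,j) \<in> carrier (poly_ring V)"
    and ab: "a < n" "b < n"
  shows "cofactor A a b \<in> carrier (poly_ring V)"
  unfolding cofactor_def
proof (intro poly_ring_mult_closed poly_ring_power_closed det_closed[OF mat_delete_carrier[OF A]])
  fix i j assume "i < n - 1" "j < n - 1"
  then show "mat_delete A a b $$ (i, j) \<in> carrier (poly_ring V)"
    using A by (auto simp: mat_delete_def intro!: ent)
qed (simp add: poly_ring_closed)

lemma pick_remove1:
  assumes "p < n" "i < n - 1"
  shows "pick ({..<n} - {p}) i = (if i < p then i else Suc i)"
proof -
  let ?i = "if i < p then i else Suc i"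
  have "{a \<in> {..<n} - {p}. a < ?i} = (if i < p then {..<i} else {..<Suc i} - {p})"
    using assms by auto
  then have "card {a \<in> {..<n} - {p}. a < ?i} = i" using assms by simp
  moreover have "?i \<in> {..<n} - {p}" using assms by auto
  ultimately show ?thesis using pick_card_in_set[of ?i "{..<n} - {p}"] by simp
qed

lemma submatrix_remove1:
  assumes A: "A \<in> carrier_mat n n" and pq: "p < n" "q < n"
  shows "submatrix A ({..<n} - {p}) ({..<n} - {q}) = mat_delete A p q"
proof -
  have card: "card {i. i < n \<and> i \<noteq> c} = n - 1" if "c < n" for c
  proof -
    have "{i. i < n \<and> i \<noteq> c} = {..<n} - {c}" by auto
    then show ?thesis using that by simp
  qed
  show ?thesis
    using A pq unfolding submatrix_def mat_delete_def
    by (intro eq_matI) (auto simp: card pick_remove1)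
qed

text \<open>
  A subset with \<open>n - 1\<close> elements omits exactly one index, so that the submatrices in question arise
  by deleting one row and one column.
\<close>

lemma submaximal_minors:
  assumes A: "A \<in> carrier_mat n n" and n: "n \<ge> 1"
  shows "minors (n - 1) A = {det (mat_delete A p q) | p q. p < n \<and> q < n}"
proof -
  have sub: "I \<subseteq> {..<n} \<and> card I = n - 1 \<longleftrightarrow> (\<exists>p<n. I = {..<n} - {p})" for I
  proof
    assume I: "I \<subseteq> {..<n} \<and> card I = n - 1"
    then have "card ({..<n} - I) = 1" using n by (subst card_Diff_subset) (auto intro: finite_subset)
    then obtain p where "{..<n} - I = {p}" by (rule card_1_singletonE)
    with I show "\<exists>p<n. I = {..<n} - {p}" by (intro exI[of _ p]) auto
  qed (use n in auto)
  have "minors (n - 1) A = {det (submatrix A I J) | I J. (I \<subseteq> {..<n} \<and> card I = n - 1) \<and> (J \<subseteq> {..<n} \<and> card J = n - 1)}"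
    using A unfolding minors_def by auto
  also have "\<dots> = {det (submatrix A ({..<n} - {p}) ({..<n} - {q})) | p q. p < n \<and> q < n}"
    unfolding sub by blast
  also have "\<dots> = {det (mat_delete A p q) | p q. p < n \<and> q < n}"
    by (rule Collect_cong) (metis submatrix_remove1[OF A])
  finally show ?thesis .
qed

lemma det_mat_delete_cofactor: "det (mat_delete A a b) = (-1)^(a+b) * cofactor A a b"
  by (simp add: cofactor_def flip: mult.assoc power_add)

section \<open>Partial derivatives\<close>

lemma mpolynomial_induct [case_names monomial add]:
  fixes p :: "'a::comm_ring_1 mpolynomial"
  assumes mono: "\<And>m c. P (Poly_Mapping.single m c)" and add: "\<And>p q. \<lbrakk>P p; P q\<rbrakk> \<Longrightarrow> P (p + q)"
  shows "P p"
proof (induction p rule: update_induct)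
  case const
  show ?case using mono[of 0 0] by simp
next
  case (update f a b)
  have "Poly_Mapping.update a b f = Poly_Mapping.single a b + f"
    using update(1) by (intro poly_mapping_eqI) (auto simp: lookup_update lookup_add lookup_single in_keys_iff when_def)
  then show ?case using add[OF mono update(3)] by simp
qed

lemma partial_deriv_single:
  "partial_deriv i (Poly_Mapping.single m c) =
    Poly_Mapping.single (m - Poly_Mapping.single i 1) (of_nat (Poly_Mapping.lookup m i) * c)"
  by (simp add: partial_deriv_def)

lemma partial_deriv_add: "partial_deriv i (p + q) = partial_deriv i p + partial_deriv i q"
proof -
  let ?t = "\<lambda>p m. Poly_Mapping.single (m - Poly_Mapping.single i 1)
        (of_nat (Poly_Mapping.lookup m i) * Poly_Mapping.lookup p m)"
  let ?S = "Poly_Mapping.keys p \<union> Poly_Mapping.keys q"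
  have *: "partial_deriv i u = (\<Sum>m\<in>?S. ?t u m)" if "Poly_Mapping.keys u \<subseteq> ?S" for u
    unfolding partial_deriv_def using that by (intro sum.mono_neutral_left) (auto simp: in_keys_iff)
  show ?thesis
    using Poly_Mapping.keys_add[of p q]
    by (simp add: * lookup_add distrib_left single_add sum.distrib)
qed

lemma partial_deriv_mult: "partial_deriv i (p * q) = partial_deriv i p * q + p * partial_deriv i q"
proof (induction p rule: mpolynomial_induct)
  case (monomial m c)
  show ?case
  proof (induction q rule: mpolynomial_induct)
    case (monomial n d)
    \<comment> \<open>Where the subtraction of exponents truncates, the coefficient vanishes.\<close>
    define e where "e = Poly_Mapping.single i (1::nat)"
    have pd: "partial_deriv i (Poly_Mapping.single u x)
        = Poly_Mapping.single (u - e) (of_nat (Poly_Mapping.lookup u i) * x)" for u and x :: 'a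
      by (simp add: partial_deriv_single e_def)
    have l: "m + n - e = (m - e) + n" if "Poly_Mapping.lookup m i \<noteq> 0"
      using that by (intro poly_mapping_eqI) (auto simp: lookup_add lookup_minus lookup_single when_def e_def)
    have r: "m + n - e = m + (n - e)" if "Poly_Mapping.lookup n i \<noteq> 0"
      using that by (intro poly_mapping_eqI) (auto simp: lookup_add lookup_minus lookup_single when_def e_def)
    have "partial_deriv i (Poly_Mapping.single m c * Poly_Mapping.single n d)
        = Poly_Mapping.single (m + n - e) (of_nat (Poly_Mapping.lookup m i) * c * d)
          + Poly_Mapping.single (m + n - e) (c * (of_nat (Poly_Mapping.lookup n i) * d))"
      by (simp add: mult_single pd lookup_add distrib_right distrib_left mult_ac flip: single_add)
    also have "Poly_Mapping.single (m + n - e) (of_nat (Poly_Mapping.lookup m i) * c * d)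
        = partial_deriv i (Poly_Mapping.single m c) * Poly_Mapping.single n d"
      by (cases "Poly_Mapping.lookup m i = 0") (simp_all add: mult_single pd l)
    also have "Poly_Mapping.single (m + n - e) (c * (of_nat (Poly_Mapping.lookup n i) * d))
        = Poly_Mapping.single m c * partial_deriv i (Poly_Mapping.single n d)"
      by (cases "Poly_Mapping.lookup n i = 0") (simp_all add: mult_single pd r)
    finally show ?case .
  qed (simp add: partial_deriv_add algebra_simps)
qed (simp add: partial_deriv_add algebra_simps)

lemma partial_deriv_Var: "partial_deriv i (Var j) = (if i = j then 1 else 0)"
  by (auto simp: Var_def partial_deriv_single lookup_single when_def)

section \<open>The gradient ideal of the Hankel determinant\<close>

abbreviation hankel_vars :: "nat \<Rightarrow> nat set" where
  "hankel_vars m \<equiv> {0..2 * m - 2}"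

abbreviation hankel_gradient :: "nat \<Rightarrow> 'a::comm_ring_1 mpolynomial set" where
  "hankel_gradient m \<equiv> gradient_ideal (hankel_vars m) (det (hankel m))"

abbreviation hankel_minors :: "nat \<Rightarrow> 'a::comm_ring_1 mpolynomial set" where
  "hankel_minors m \<equiv> minor_ideal (hankel_vars m) (m - 1) (hankel m)"

lemma hankel_carrier_mat [simp]: "hankel m \<in> carrier_mat m m"
  by (simp add: hankel_def)

lemma hankel_index [simp]: "\<lbrakk>i < m; j < m\<rbrakk> \<Longrightarrow> hankel m $$ (i,j) = Var (i + j)"
  by (simp add: hankel_def)

lemma hankel_entry_closed:
  "\<lbrakk>i < n; j < n; n \<le> m\<rbrakk> \<Longrightarrow> hankel n $$ (i,j) \<in> carrier (poly_ring (hankel_vars m))"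
  by (auto intro!: Var_closed)

lemma hankel_cofactor_closed:
  assumes "a < n" "b < n" "n \<le> m"
  shows "cofactor (hankel n) a b \<in> carrier (poly_ring (hankel_vars m))"
  by (rule cofactor_closed[OF hankel_carrier_mat hankel_entry_closed]) (use assms in auto)

lemma hankel_det_closed:
  "n \<le> m \<Longrightarrow> det (hankel n) \<in> carrier (poly_ring (hankel_vars m))"
  by (rule det_closed[OF hankel_carrier_mat hankel_entry_closed])

lemma hankel_cofactor_sym:
  "\<lbrakk>a < m; b < m\<rbrakk> \<Longrightarrow> cofactor (hankel m) a b = cofactor (hankel m) b a"
  by (rule cofactor_symmetric[OF hankel_carrier_mat]) (auto simp: add.commute)

lemma partial_deriv_hankel_det:
  "partial_deriv i (det (hankel m) :: 'a::comm_ring_1 mpolynomial) =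
    (\<Sum>(a,b) | a < m \<and> b < m \<and> a + b = i. cofactor (hankel m) a b)"
proof -
  have "partial_deriv i (det (hankel m) :: 'a mpolynomial)
      = (\<Sum>a<m. \<Sum>b<m. if a + b = i then cofactor (hankel m) a b else 0)"
    by (subst det_derivation[where D = "partial_deriv i", OF partial_deriv_add partial_deriv_mult hankel_carrier_mat],
        intro sum.cong) (auto simp: partial_deriv_Var)
  also have "\<dots> = (\<Sum>(a,b) \<in> {..<m} \<times> {..<m}. if a + b = i then cofactor (hankel m) a b else 0)"
    by (simp add: sum.cartesian_product)
  also have "\<dots> = (\<Sum>(a,b) | a < m \<and> b < m \<and> a + b = i. cofactor (hankel m) a b)"
    by (rule sum.mono_neutral_cong_right) (auto split: if_splits)
  finally show ?thesis .
qed

lemma ideal_hankel_gradient: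
  "ideal (hankel_gradient m :: 'a::comm_ring_1 mpolynomial set) (poly_ring (hankel_vars m))"
  and partial_deriv_in_hankel_gradient:
  "i \<le> 2 * m - 2 \<Longrightarrow> partial_deriv i (det (hankel m)) \<in> (hankel_gradient m :: 'a mpolynomial set)"
proof -
  interpret cring "poly_ring (hankel_vars m) :: 'a mpolynomial ring" by (rule poly_ring_cring)
  have sub: "{partial_deriv i (det (hankel m)) | i. i \<in> hankel_vars m}
      \<subseteq> carrier (poly_ring (hankel_vars m) :: 'a mpolynomial ring)"
    by (auto simp: partial_deriv_hankel_det intro!: poly_ring_sum_closed hankel_cofactor_closed)
  show "ideal (hankel_gradient m :: 'a mpolynomial set) (poly_ring (hankel_vars m))"
    unfolding gradient_ideal_def by (rule genideal_ideal[OF sub])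
  show "i \<le> 2 * m - 2 \<Longrightarrow> partial_deriv i (det (hankel m)) \<in> (hankel_gradient m :: 'a mpolynomial set)"
    unfolding gradient_ideal_def using genideal_self[OF sub] by auto
qed

lemma hankel_minor_closed:
  assumes "p < m" "q < m"
  shows "det (mat_delete (hankel m) p q) \<in> carrier (poly_ring (hankel_vars m))"
proof (rule det_closed[OF mat_delete_carrier[OF hankel_carrier_mat]])
  fix i j assume "i < m - 1" "j < m - 1"
  then show "mat_delete (hankel m) p q $$ (i, j) \<in> carrier (poly_ring (hankel_vars m))"
    by (auto simp: mat_delete_def hankel_def intro!: Var_closed)
qed

lemma ideal_hankel_minors:
  assumes "m \<ge> 1"
  shows "ideal (hankel_minors m :: 'a::comm_ring_1 mpolynomial set) (poly_ring (hankel_vars m))"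
    and "\<lbrakk>p < m; q < m\<rbrakk> \<Longrightarrow> det (mat_delete (hankel m) p q) \<in> (hankel_minors m :: 'a mpolynomial set)"
    and "\<lbrakk>ideal I (poly_ring (hankel_vars m)); \<And>a b. \<lbrakk>a < m; b < m\<rbrakk> \<Longrightarrow> det (mat_delete (hankel m) a b) \<in> I\<rbrakk>
      \<Longrightarrow> (hankel_minors m :: 'a mpolynomial set) \<subseteq> I"
proof -
  interpret cring "poly_ring (hankel_vars m) :: 'a mpolynomial ring" by (rule poly_ring_cring)
  let ?M = "{det (mat_delete (hankel m) p q) | p q. p < m \<and> q < m} :: 'a mpolynomial set"
  have eq: "hankel_minors m = Idl\<^bsub>poly_ring (hankel_vars m)\<^esub> ?M"
    unfolding minor_ideal_def submaximal_minors[OF hankel_carrier_mat assms] ..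
  have sub: "?M \<subseteq> carrier (poly_ring (hankel_vars m))" by (auto intro: hankel_minor_closed)
  show "ideal (hankel_minors m :: 'a mpolynomial set) (poly_ring (hankel_vars m))"
    unfolding eq by (rule genideal_ideal[OF sub])
  show "\<lbrakk>p < m; q < m\<rbrakk> \<Longrightarrow> det (mat_delete (hankel m) p q) \<in> (hankel_minors m :: 'a mpolynomial set)"
    unfolding eq using genideal_self[OF sub] by blast
  show "\<lbrakk>ideal I (poly_ring (hankel_vars m)); \<And>a b. \<lbrakk>a < m; b < m\<rbrakk> \<Longrightarrow> det (mat_delete (hankel m) a b) \<in> I\<rbrakk>
      \<Longrightarrow> (hankel_minors m :: 'a mpolynomial set) \<subseteq> I"
    unfolding eq by (rule genideal_minimal) auto
qed

lemma hankel_gradient_subset_minors: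
  assumes m: "m \<ge> 1"
  shows "(hankel_gradient m :: 'a::comm_ring_1 mpolynomial set) \<subseteq> hankel_minors m"
proof -
  interpret cring "poly_ring (hankel_vars m) :: 'a mpolynomial ring" by (rule poly_ring_cring)
  note P = ideal_hankel_minors[OF m, where 'a = 'a]
  have cof: "cofactor (hankel m) a b \<in> (hankel_minors m :: 'a mpolynomial set)" if "a < m" "b < m" for a b
    unfolding cofactor_def
    by (intro poly_ring_ideal_mult[OF P(1)] poly_ring_power_closed P(2) that) (simp add: poly_ring_closed)
  show ?thesis
    unfolding gradient_ideal_def
    by (rule genideal_minimal[OF P(1)])
      (auto simp: partial_deriv_hankel_det simp del: One_nat_def intro!: poly_ring_ideal_sum[OF P(1)] cof)
qed

lemma antidiagonal_cofactor_sum: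
  assumes "i \<le> 2 * m - 2"
  shows "(\<Sum>(a,b) | a < m \<and> b < m \<and> a + b = i. cofactor (hankel m) a b) \<in> (hankel_gradient m :: 'a::comm_ring_1 mpolynomial set)"
  using partial_deriv_in_hankel_gradient[OF assms, where 'a = 'a] by (simp add: partial_deriv_hankel_det)

text \<open>
  Euler's formula: summing the Laplace expansions along all rows and collecting the products
  according to the antidiagonal of the entry gives \<open>m\<close> times the determinant.
\<close>

lemma hankel_det_in_gradient:
  assumes m: "m \<ge> 1"
  shows "det (hankel m) \<in> (hankel_gradient m :: 'k::field_char_0 mpolynomial set)"
proof -
  let ?H = "hankel m :: 'k mpolynomial mat" and ?J = "hankel_gradient m :: 'k mpolynomial set"
  note J = ideal_hankel_gradient[of m, where 'a = 'k]
  let ?P = "{(a,b). a < m \<and> b < m}"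
  have fin: "finite ?P" by (rule finite_subset[of _ "{..<m} \<times> {..<m}"]) auto
  have "of_nat m * det ?H = (\<Sum>a<m. \<Sum>b<m. ?H $$ (a,b) * cofactor ?H a b)"
    using cofactor_orthogonal_rows[of ?H m] by (simp del: hankel_index)
  also have "\<dots> = (\<Sum>(a,b)\<in>{..<m} \<times> {..<m}. Var (a + b) * cofactor ?H a b)"
    unfolding sum.cartesian_product by (intro sum.cong) auto
  also have "{..<m} \<times> {..<m} = ?P" by auto
  also have "(\<Sum>(a,b)\<in>?P. Var (a + b) * cofactor ?H a b)
      = (\<Sum>i\<in>{..2 * m - 2}. \<Sum>(a,b)\<in>{x \<in> ?P. (\<lambda>(a,b). a + b) x = i}. Var (a + b) * cofactor ?H a b)"
    by (rule sum.group[symmetric, OF fin]) auto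
  also have "\<dots> = (\<Sum>i\<in>{..2 * m - 2}. Var i * (\<Sum>(a,b) | a < m \<and> b < m \<and> a + b = i. cofactor ?H a b))"
    unfolding sum_distrib_left by (intro sum.cong) auto
  also have "\<dots> \<in> ?J"
    by (intro poly_ring_ideal_sum[OF J] poly_ring_ideal_mult[OF J] antidiagonal_cofactor_sum Var_closed) auto
  finally have "of_nat m * det ?H \<in> ?J" .
  with m show ?thesis using of_nat_cancel_in_ideal[OF J, of m "det ?H"] by linarith
qed

text \<open>
  Subtracting the other terms from the antidiagonal sum isolates the middle one. The factor \<open>c\<close> is 1
  for membership in the radical and the leading minor for membership in the gradient ideal.
\<close>

lemma antidiagonal_middle:
  fixes I :: "'a::comm_ring_1 mpolynomial set"
  assumes I: "ideal I (poly_ring (hankel_vars m))" and JI: "hankel_gradient m \<subseteq> I"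
    and c: "c \<in> carrier (poly_ring (hankel_vars m))" and l: "l < m"
    and off: "\<And>a b. \<lbrakk>a < m; b < m; a + b = 2 * l; a \<noteq> b\<rbrakk> \<Longrightarrow> c * cofactor (hankel m) a b \<in> I"
  shows "c * cofactor (hankel m) l l \<in> I"
proof -
  let ?S = "{(a,b). a < m \<and> b < m \<and> a + b = 2 * l}" and ?g = "\<lambda>(a,b). cofactor (hankel m) a b :: 'a mpolynomial"
  have fin: "finite ?S" by (rule finite_subset[of _ "{..<m} \<times> {..<m}"]) auto
  have "c * sum ?g ?S \<in> I"
    using l JI antidiagonal_cofactor_sum[of "2 * l" m, where 'a = 'a] by (intro poly_ring_ideal_mult[OF I c]) auto
  moreover have "c * sum ?g (?S - {(l,l)}) \<in> I"
    unfolding sum_distrib_left by (rule poly_ring_ideal_sum[OF I]) (auto intro!: off)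
  ultimately have "c * sum ?g ?S - c * sum ?g (?S - {(l,l)}) \<in> I" by (rule poly_ring_ideal_diff[OF I])
  moreover have "sum ?g ?S = ?g (l,l) + sum ?g (?S - {(l,l)})"
    using l fin by (intro sum.remove) auto
  ultimately show ?thesis by (simp add: algebra_simps)
qed

text \<open>
  Descending induction on the row \<open>l\<close>. The rows below are known to lie in the radical, so the
  antidiagonal sum through the diagonal position \<open>(l, l)\<close> leaves only the cofactor there; modulo
  the determinant the square of any other cofactor in row \<open>l\<close> is a multiple of it.
\<close>

lemma hankel_minors_subset_radical:
  assumes m: "m \<ge> 1"
  shows "(hankel_minors m :: 'k::field_char_0 mpolynomial set)
    \<subseteq> radical (poly_ring (hankel_vars m)) (hankel_gradient m)"
proof -
  let ?R = "poly_ring (hankel_vars m) :: 'k mpolynomial ring" and ?J = "hankel_gradient m :: 'k mpolynomial set"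
  let ?C = "\<lambda>a b. cofactor (hankel m) a b :: 'k mpolynomial"
  note J = ideal_hankel_gradient[of m, where 'a = 'k]
  note rad = ideal_radical[OF J]
  have Jrad: "?J \<subseteq> radical ?R ?J" by (rule cring.ideal_subset_radical[OF poly_ring_cring J])
  have main: "\<forall>b<m. ?C l b \<in> radical ?R ?J" if "l < m" for l
    using that
  proof (induction "m - l" arbitrary: l rule: less_induct)
    case less
    have above: "?C a b \<in> radical ?R ?J" if "l < a" "a < m" "b < m" for a b
      using less(1)[of a] less(2) that by auto
    have "1 * ?C l l \<in> radical ?R ?J"
    proof (rule antidiagonal_middle[OF rad Jrad poly_ring_one_closed less(2)])
      fix a b assume ab: "a < m" "b < m" "a + b = 2 * l" "a \<noteq> b"
      then have "l < a \<or> l < b" by linarith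
      then show "1 * ?C a b \<in> radical ?R ?J"
        using above[of a b] above[of b a] ab hankel_cofactor_sym[of a m b, where 'a = 'k] by auto
    qed
    then have ll: "?C l l \<in> radical ?R ?J" by simp
    show ?case
    proof (intro allI impI)
      fix b assume b: "b < m"
      show "?C l b \<in> radical ?R ?J"
      proof (cases "b = l")
        case False
        obtain B :: "'k mpolynomial mat" where B: "B \<in> carrier_mat m m"
          "\<forall>i<m. \<forall>j<m. B $$ (i,j) \<in> {0, 1, hankel m $$ (i,j)}"
          "?C l l * ?C b b - ?C l b * ?C b l = det (hankel m) * cofactor B b b"
          using principal_cofactor_minor[OF hankel_carrier_mat less(2) b] False by metis
        have Bc: "cofactor B b b \<in> carrier ?R"
        proof (rule cofactor_closed[OF B(1) _ b b])
          fix i j assume "i < m" "j < m"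
          then show "B $$ (i,j) \<in> carrier ?R"
            using B(2)[rule_format, of i j] hankel_entry_closed[of i m j m, where 'a = 'k]
            by (auto simp: poly_ring_closed)
        qed
        have sq: "?C l b ^ 2 = ?C b b * ?C l l - cofactor B b b * det (hankel m)"
          using B(3) hankel_cofactor_sym[OF b less(2), where 'a = 'k] by (simp add: power2_eq_square algebra_simps)
        have "?C l b ^ 2 \<in> radical ?R ?J" unfolding sq
          using hankel_det_in_gradient[OF m, where 'k = 'k] Jrad b
          by (intro poly_ring_ideal_diff[OF rad] poly_ring_ideal_mult[OF rad] ll Bc hankel_cofactor_closed) auto
        then obtain n where "?C l b ^ (2 * n) \<in> ?J" unfolding radical_def poly_ring_nat_pow power_mult by blast
        then show ?thesis
          using hankel_cofactor_closed[OF less(2) b order_refl, where 'a = 'k]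
          unfolding radical_def poly_ring_nat_pow by blast
      qed (simp add: ll)
    qed
  qed
  show ?thesis
  proof (rule ideal_hankel_minors(3)[OF m rad])
    fix a b assume "a < m" "b < m"
    then show "det (mat_delete (hankel m) a b) \<in> radical ?R ?J"
      unfolding det_mat_delete_cofactor using main
      by (intro poly_ring_ideal_mult[OF rad] poly_ring_power_closed) (auto simp: poly_ring_closed)
  qed
qed

section \<open>The gradient ideal away from the leading minor\<close>

text \<open>
  Column \<open>b\<close> of the adjugate is killed by the Hankel matrix modulo the gradient ideal. The first \<open>r\<close>
  of these linear relations express, after multiplication by the adjugate of the leading block, the
  first \<open>r\<close> entries of the column times \<open>det (hankel r)\<close> through the last two entries.
\<close>

lemma leading_minor_times_cofactor:
  fixes t :: "'k::field_char_0 mpolynomial"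
  assumes t: "t \<in> carrier (poly_ring (hankel_vars (r + 2)))" and b: "b < r + 2"
    and last: "t * cofactor (hankel (r + 2)) r b \<in> hankel_gradient (r + 2)"
      "t * cofactor (hankel (r + 2)) (Suc r) b \<in> hankel_gradient (r + 2)"
    and a: "a < r"
  shows "t * det (hankel r) * cofactor (hankel (r + 2)) a b \<in> hankel_gradient (r + 2)"
proof -
  let ?m = "r + 2"
  let ?R = "poly_ring (hankel_vars ?m) :: 'k mpolynomial ring" and ?J = "hankel_gradient ?m :: 'k mpolynomial set"
  let ?C = "\<lambda>a b. cofactor (hankel ?m) a b :: 'k mpolynomial"
  note J = ideal_hankel_gradient[of ?m, where 'a = 'k]
  define S where "S i = (\<Sum>c<r. Var (i + c) * ?C c b)" for i
  have tS: "t * S i \<in> ?J" if i: "i < r" for i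
  proof -
    have "(\<Sum>c<?m. hankel ?m $$ (i,c) * ?C c b) = (\<Sum>c<?m. hankel ?m $$ (i,c) * ?C b c)"
    proof (intro sum.cong refl)
      fix c assume "c \<in> {..<?m}"
      then have "?C c b = ?C b c" using b by (intro hankel_cofactor_sym) auto
      then show "hankel ?m $$ (i,c) * ?C c b = hankel ?m $$ (i,c) * ?C b c" by (simp only:)
    qed
    also have "\<dots> = (if i = b then det (hankel ?m) else 0)"
      using i b by (intro cofactor_orthogonal_rows) auto
    also have "\<dots> \<in> ?J"
      using hankel_det_in_gradient[of ?m, where 'k = 'k] poly_ring_ideal_zero[OF J] by simp
    finally have "(\<Sum>c<?m. hankel ?m $$ (i,c) * ?C c b) \<in> ?J" .
    moreover have "(\<Sum>c<?m. hankel ?m $$ (i,c) * ?C c b)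
        = S i + Var (i + r) * ?C r b + Var (i + Suc r) * ?C (Suc r) b"
    proof -
      have "(\<Sum>c<r. hankel ?m $$ (i,c) * ?C c b) = S i"
        unfolding S_def using i by (intro sum.cong refl) simp
      moreover have "{..<?m} = {..<Suc (Suc r)}" by simp
      ultimately show ?thesis using i by (simp only: sum.lessThan_Suc) simp
    qed
    ultimately have "S i + Var (i + r) * ?C r b + Var (i + Suc r) * ?C (Suc r) b \<in> ?J" by (simp only:)
    from poly_ring_ideal_mult[OF J t this]
    have all: "t * (S i + Var (i + r) * ?C r b + Var (i + Suc r) * ?C (Suc r) b) \<in> ?J" .
    have "Var (i + r) * (t * ?C r b) \<in> ?J"
      by (rule poly_ring_ideal_mult[OF J Var_closed last(1)]) (use i in simp)
    moreover have "Var (i + Suc r) * (t * ?C (Suc r) b) \<in> ?J"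
      by (rule poly_ring_ideal_mult[OF J Var_closed last(2)]) (use i in simp)
    ultimately have "t * (S i + Var (i + r) * ?C r b + Var (i + Suc r) * ?C (Suc r) b)
        - Var (i + r) * (t * ?C r b) - Var (i + Suc r) * (t * ?C (Suc r) b) \<in> ?J"
      using all by (intro poly_ring_ideal_diff[OF J])
    also have "t * (S i + Var (i + r) * ?C r b + Var (i + Suc r) * ?C (Suc r) b)
        - Var (i + r) * (t * ?C r b) - Var (i + Suc r) * (t * ?C (Suc r) b) = t * S i"
      by (simp only: distrib_left mult.left_commute[of t]) simp
    finally show ?thesis .
  qed
  have "(\<Sum>i<r. cofactor (hankel r) i a * (t * S i))
      = (\<Sum>i<r. \<Sum>c<r. t * ?C c b * (hankel r $$ (i,c) * cofactor (hankel r) i a))"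
    unfolding S_def sum_distrib_left by (intro sum.cong refl) (simp add: algebra_simps)
  also have "\<dots> = (\<Sum>c<r. t * ?C c b * (\<Sum>i<r. hankel r $$ (i,c) * cofactor (hankel r) i a))"
    unfolding sum_distrib_left by (rule sum.swap)
  also have "\<dots> = (\<Sum>c<r. if c = a then t * ?C c b * det (hankel r) else 0)"
    using a by (intro sum.cong refl) (simp add: cofactor_orthogonal_cols[OF hankel_carrier_mat] del: hankel_index)
  also have "\<dots> = t * det (hankel r) * ?C a b" using a by (simp add: ac_simps)
  finally have "t * det (hankel r) * ?C a b = (\<Sum>i<r. cofactor (hankel r) i a * (t * S i))" ..
  also have "\<dots> \<in> ?J"
  proof (rule poly_ring_ideal_sum[OF J])
    fix i assume "i \<in> {..<r}"
    then show "cofactor (hankel r) i a * (t * S i) \<in> ?J"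
      using a by (intro poly_ring_ideal_mult[OF J hankel_cofactor_closed tS]) auto
  qed
  finally show ?thesis .
qed

text \<open>
  The last three antidiagonal sums show in turn that the cofactors in the lower right 2-by-2 corner,
  multiplied by \<open>\<Delta>\<close> where necessary, lie in the gradient ideal; the other cofactors are reached
  column by column. The worst position collects one factor \<open>\<Delta>\<close> from the corner, one on the
  way up its column and one on the way along the row.
\<close>

lemma leading_minor_cubed_times_minors:
  fixes x :: "'k::field_char_0 mpolynomial"
  assumes x: "x \<in> hankel_minors (r + 2)"
  shows "det (hankel r) ^ 3 * x \<in> hankel_gradient (r + 2)"
proof -
  let ?m = "r + 2"
  let ?R = "poly_ring (hankel_vars ?m) :: 'k mpolynomial ring" and ?J = "hankel_gradient ?m :: 'k mpolynomial set"
  let ?C = "\<lambda>a b. cofactor (hankel ?m) a b :: 'k mpolynomial" and ?d = "det (hankel r) :: 'k mpolynomial"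
  note J = ideal_hankel_gradient[of ?m, where 'a = 'k]
  have d: "?d \<in> carrier ?R" by (rule hankel_det_closed) simp
  have dn: "?d ^ n \<in> carrier ?R" for n by (rule poly_ring_power_closed[OF d])
  have sym: "?C a b = ?C b a" if "a < ?m" "b < ?m" for a b by (rule hankel_cofactor_sym[OF that])
  have c11: "?C (Suc r) (Suc r) \<in> ?J"
    using antidiagonal_middle[OF J order_refl poly_ring_one_closed, of "Suc r"] by simp
  have c01: "?C r (Suc r) \<in> ?J"
  proof -
    have "{(a,b). a < ?m \<and> b < ?m \<and> a + b = 2 * r + 1} = {(r, Suc r), (Suc r, r)}" by auto
    then have "?C r (Suc r) + ?C (Suc r) r \<in> ?J"
      using antidiagonal_cofactor_sum[of "2 * r + 1" ?m, where 'a = 'k] by simp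
    then have "of_nat 2 * ?C r (Suc r) \<in> ?J" using sym[of r "Suc r"] by simp
    then show ?thesis using of_nat_cancel_in_ideal[OF J, of 2] by simp
  qed
  have col1: "?d * ?C a (Suc r) \<in> ?J" if "a < r" for a
    using leading_minor_times_cofactor[of 1 r "Suc r" a] c01 c11 that by (simp add: poly_ring_one_closed)
  have c00: "?d * ?C r r \<in> ?J"
  proof (rule antidiagonal_middle[OF J order_refl d])
    fix a b assume "a < ?m" "b < ?m" "a + b = 2 * r" "a \<noteq> b"
    then have "b = Suc r \<and> a < r \<or> a = Suc r \<and> b < r" by auto
    then show "?d * ?C a b \<in> ?J" using col1[of a] col1[of b] sym[of a b] by auto
  qed simp
  have col0: "?d ^ 2 * ?C a r \<in> ?J" if "a < r" for a
  proof -
    have "?d * ?C (Suc r) r \<in> ?J"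
      using poly_ring_ideal_mult[OF J d c01] sym[of r "Suc r"] by simp
    from leading_minor_times_cofactor[OF d _ c00 this that] show ?thesis by (simp add: power2_eq_square)
  qed
  have low: "?d ^ 2 * ?C a b \<in> ?J" if ab: "a = r \<or> a = Suc r" "b < ?m" for a b
  proof -
    consider "b < r" | "b = r" | "b = Suc r" using ab(2) by linarith
    then show ?thesis
    proof cases
      case 1
      then show ?thesis
        using ab col0[of b] poly_ring_ideal_mult[OF J d col1[of b]] sym[of a b]
        by (auto simp: power2_eq_square mult.assoc)
    next
      case 2
      then show ?thesis
        using ab poly_ring_ideal_mult[OF J d c00] poly_ring_ideal_mult[OF J dn c01, of 2] sym[of r "Suc r"]
        by (auto simp: power2_eq_square mult.assoc)
    next
      case 3
      then show ?thesis
        using ab poly_ring_ideal_mult[OF J dn c11, of 2] poly_ring_ideal_mult[OF J dn c01, of 2] by auto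
    qed
  qed
  have all: "?d ^ 3 * ?C a b \<in> ?J" if ab: "a < ?m" "b < ?m" for a b
  proof (cases "a < r")
    case True
    have "?d ^ 2 * ?d * ?C a b \<in> ?J"
      using low ab by (intro leading_minor_times_cofactor[OF dn _ _ _ True]) auto
    then show ?thesis by (simp add: power3_eq_cube power2_eq_square)
  next
    case False
    then have "?d * (?d ^ 2 * ?C a b) \<in> ?J" using ab by (intro poly_ring_ideal_mult[OF J d] low) auto
    then show ?thesis by (simp add: power3_eq_cube power2_eq_square mult.assoc)
  qed
  have "ideal {y \<in> carrier ?R. ?d ^ 3 * y \<in> ?J} ?R" by (rule ideal_colon[OF J])
  moreover have "det (mat_delete (hankel ?m) a b) \<in> {y \<in> carrier ?R. ?d ^ 3 * y \<in> ?J}" if "a < ?m" "b < ?m" for a b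
  proof -
    have "(-1) ^ (a + b) * (?d ^ 3 * ?C a b) \<in> ?J"
      by (intro poly_ring_ideal_mult[OF J] poly_ring_power_closed all that) (simp add: poly_ring_closed)
    then show ?thesis
      using hankel_minor_closed[OF that, where 'a = 'k] by (simp add: det_mat_delete_cofactor ac_simps)
  qed
  ultimately have "hankel_minors ?m \<subseteq> {y \<in> carrier ?R. ?d ^ 3 * y \<in> ?J}"
    by (intro ideal_hankel_minors(3)) auto
  then show ?thesis using x by blast
qed

section \<open>Substitution of polynomials for variables\<close>

definition monom_subst :: "(nat \<Rightarrow> 'a::comm_ring_1 mpolynomial) \<Rightarrow> (nat \<Rightarrow>\<^sub>0 nat) \<Rightarrow> 'a mpolynomial" where
  "monom_subst \<theta> N = (\<Prod>i\<in>Poly_Mapping.keys N. \<theta> i ^ Poly_Mapping.lookup N i)"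

definition poly_subst :: "(nat \<Rightarrow> 'a::comm_ring_1 mpolynomial) \<Rightarrow> 'a mpolynomial \<Rightarrow> 'a mpolynomial" where
  "poly_subst \<theta> p =
    (\<Sum>N\<in>Poly_Mapping.keys p. Poly_Mapping.single 0 (Poly_Mapping.lookup p N) * monom_subst \<theta> N)"

lemma monom_subst_add: "monom_subst \<theta> (M + N) = monom_subst \<theta> M * monom_subst \<theta> N"
proof -
  let ?S = "Poly_Mapping.keys M \<union> Poly_Mapping.keys N"
  have *: "monom_subst \<theta> L = (\<Prod>i\<in>?S. \<theta> i ^ Poly_Mapping.lookup L i)" if "Poly_Mapping.keys L \<subseteq> ?S" for L
    unfolding monom_subst_def using that by (intro prod.mono_neutral_left) (auto simp: in_keys_iff)
  show ?thesis using Poly_Mapping.keys_add[of M N] by (simp add: * lookup_add power_add prod.distrib)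
qed

lemma monom_subst_zero [simp]: "monom_subst \<theta> 0 = 1"
  by (simp add: monom_subst_def)

lemma monom_subst_single [simp]: "monom_subst \<theta> (Poly_Mapping.single i n) = \<theta> i ^ n"
  by (simp add: monom_subst_def)

lemma poly_subst_single [simp]:
  "poly_subst \<theta> (Poly_Mapping.single N c) = Poly_Mapping.single 0 c * monom_subst \<theta> N"
  by (simp add: poly_subst_def)

lemma poly_subst_add: "poly_subst \<theta> (p + q) = poly_subst \<theta> p + poly_subst \<theta> q"
proof -
  let ?S = "Poly_Mapping.keys p \<union> Poly_Mapping.keys q"
  have *: "poly_subst \<theta> u = (\<Sum>N\<in>?S. Poly_Mapping.single 0 (Poly_Mapping.lookup u N) * monom_subst \<theta> N)"
    if "Poly_Mapping.keys u \<subseteq> ?S" for u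
    unfolding poly_subst_def using that by (intro sum.mono_neutral_left) (auto simp: in_keys_iff)
  show ?thesis using Poly_Mapping.keys_add[of p q]
    by (simp add: * lookup_add single_add distrib_right sum.distrib)
qed

lemma poly_subst_mult: "poly_subst \<theta> (p * q) = poly_subst \<theta> p * poly_subst \<theta> q"
proof (induction p rule: mpolynomial_induct)
  case (monomial M c)
  show ?case
  proof (induction q rule: mpolynomial_induct)
    case (monomial N d)
    have "poly_subst \<theta> (Poly_Mapping.single M c * Poly_Mapping.single N d)
        = Poly_Mapping.single 0 (c * d) * (monom_subst \<theta> M * monom_subst \<theta> N)"
      by (simp add: mult_single monom_subst_add)
    also have "Poly_Mapping.single 0 (c * d)
        = (Poly_Mapping.single 0 c * Poly_Mapping.single 0 d :: 'a mpolynomial)"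
      by (simp add: mult_single)
    finally show ?case by (simp add: ac_simps)
  qed (simp add: poly_subst_add algebra_simps)
qed (simp add: poly_subst_add algebra_simps)

lemma poly_subst_one: "poly_subst \<theta> 1 = 1"
  using poly_subst_single[of \<theta> 0 1] by simp

lemma poly_subst_Var: "poly_subst \<theta> (Var i) = \<theta> i"
  by (simp add: Var_def)

lemma poly_subst_comm_ring_hom: "comm_ring_hom (poly_subst \<theta>)"
proof
  show "poly_subst \<theta> 0 = 0" using poly_subst_add[of \<theta> 0 0] by simp
qed (simp_all add: poly_subst_add poly_subst_mult poly_subst_one)

section \<open>Weights of monomials\<close>

definition wsum :: "(nat \<Rightarrow> int) \<Rightarrow> (nat \<Rightarrow>\<^sub>0 nat) \<Rightarrow> int" where
  "wsum h N = (\<Sum>i\<in>Poly_Mapping.keys N. h i * int (Poly_Mapping.lookup N i))"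

abbreviation "mdeg \<equiv> wsum (\<lambda>_. 1)"
abbreviation "mindex \<equiv> wsum int"
abbreviation "mweight \<equiv> wsum (\<lambda>i. int i ^ 2)"

lemma wsum_superset:
  "\<lbrakk>finite S; Poly_Mapping.keys N \<subseteq> S\<rbrakk> \<Longrightarrow> wsum h N = (\<Sum>i\<in>S. h i * int (Poly_Mapping.lookup N i))"
  unfolding wsum_def by (intro sum.mono_neutral_left) (auto simp: in_keys_iff)

lemma wsum_add: "wsum h (M + N) = wsum h M + wsum h N"
proof -
  let ?S = "Poly_Mapping.keys M \<union> Poly_Mapping.keys N"
  show ?thesis using Poly_Mapping.keys_add[of M N]
    by (simp add: wsum_superset[of ?S] lookup_add algebra_simps sum.distrib)
qed

lemma wsum_zero [simp]: "wsum h 0 = 0"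
  by (simp add: wsum_def)

lemma wsum_single [simp]: "wsum h (Poly_Mapping.single i n) = h i * int n"
  by (simp add: wsum_def)

lemma wsum_sum: "wsum h (sum F S) = (\<Sum>x\<in>S. wsum h (F x))"
  by (induction S rule: infinite_finite_induct) (simp_all add: wsum_add)

lemma wsum_nonneg: "(\<And>i. h i \<ge> 0) \<Longrightarrow> wsum h N \<ge> 0"
  unfolding wsum_def by (intro sum_nonneg) auto

text \<open>
  The polynomial \<open>(i - b) * (i - b - 1)\<close> is nonnegative on the integers and vanishes only at \<open>b\<close> and
  \<open>b + 1\<close>. Its weighted sum differs from the weight by a combination of degree and index sum, which
  are the same for both monomials, and it vanishes on \<open>A\<close>.
\<close>

lemma balanced_minimal_weight:
  assumes A: "Poly_Mapping.keys A \<subseteq> {b, Suc b}"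
    and deg: "mdeg B = mdeg A" and idx: "mindex B = mindex A"
  shows "mweight A \<le> mweight B" and "mweight A = mweight B \<Longrightarrow> A = B"
proof -
  define e where "e i = (int i - int b) * (int i - int b - 1)" for i
  have e: "wsum e N = mweight N - (2 * int b + 1) * mindex N + int b * (int b + 1) * mdeg N" for N
    unfolding wsum_def sum_distrib_left sum_subtractf[symmetric] sum.distrib[symmetric]
    by (intro sum.cong) (auto simp: e_def algebra_simps power2_eq_square)
  have e_nonneg: "e i \<ge> 0" for i
    unfolding e_def by (cases "i \<le> b") (auto intro: mult_nonneg_nonneg mult_nonpos_nonpos)
  have eA: "wsum e A = 0"
    unfolding wsum_def using A by (intro sum.neutral) (auto simp: e_def)
  have diff: "mweight B - mweight A = wsum e B" using e[of A] e[of B] eA deg idx by simp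
  then show "mweight A \<le> mweight B" using wsum_nonneg[of e B] e_nonneg by simp
  assume "mweight A = mweight B"
  then have eB: "wsum e B = 0" using diff by simp
  have B: "Poly_Mapping.keys B \<subseteq> {b, Suc b}"
  proof
    fix i assume i: "i \<in> Poly_Mapping.keys B"
    have "e i * int (Poly_Mapping.lookup B i) = 0"
      using eB i unfolding wsum_def by (subst (asm) sum_nonneg_eq_0_iff) (auto simp: e_nonneg)
    then have "int i - int b = 0 \<or> int i - int b - 1 = 0" using i by (simp add: e_def in_keys_iff)
    then show "i \<in> {b, Suc b}" by auto
  qed
  have two: "wsum h N = h b * int (Poly_Mapping.lookup N b) + h (Suc b) * int (Poly_Mapping.lookup N (Suc b))"
    if "Poly_Mapping.keys N \<subseteq> {b, Suc b}" for h N
    using that by (subst wsum_superset[of "{b, Suc b}"]) auto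
  have sum: "int (Poly_Mapping.lookup B b) + int (Poly_Mapping.lookup B (Suc b))
      = int (Poly_Mapping.lookup A b) + int (Poly_Mapping.lookup A (Suc b))"
    using deg two[OF A] two[OF B] by simp
  moreover have "int b * (int (Poly_Mapping.lookup B b) + int (Poly_Mapping.lookup B (Suc b))) + int (Poly_Mapping.lookup B (Suc b))
      = int b * (int (Poly_Mapping.lookup A b) + int (Poly_Mapping.lookup A (Suc b))) + int (Poly_Mapping.lookup A (Suc b))"
    using idx two[OF A] two[OF B] by (simp add: algebra_simps)
  ultimately have eq: "Poly_Mapping.lookup A b = Poly_Mapping.lookup B b"
    "Poly_Mapping.lookup A (Suc b) = Poly_Mapping.lookup B (Suc b)" by auto
  show "A = B"
  proof (rule poly_mapping_eqI)
    fix i show "Poly_Mapping.lookup A i = Poly_Mapping.lookup B i"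
    proof (cases "i \<in> {b, Suc b}")
      case False
      then have "i \<notin> Poly_Mapping.keys A" "i \<notin> Poly_Mapping.keys B" using A B by auto
      then show ?thesis by (simp add: in_keys_iff)
    qed (use eq in auto)
  qed
qed

section \<open>Monomials covered by pairs of neighbours\<close>

text \<open>
  The pairs may overlap or repeat; for \<open>r = 0\<close> only the monomial 1 is coverable.
\<close>

definition coverable :: "nat \<Rightarrow> (nat \<Rightarrow>\<^sub>0 nat) \<Rightarrow> bool" where
  "coverable r N \<longleftrightarrow> (\<exists>b. Poly_Mapping.keys N \<subseteq> (\<Union>j<r. {b j, Suc (b j)}))"

text \<open>
  Greedy choice: cover the minimum of \<open>S\<close> and its successor by one pair. All remaining elements
  exceed the minimum by at least two, so that a chain among them can be prolonged by the minimum.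
\<close>

lemma pairs_or_chain:
  fixes S :: "nat set"
  assumes "finite S"
  shows "(\<exists>b. S \<subseteq> (\<Union>j<r. {b j, Suc (b j)})) \<or>
    (\<exists>a. (\<forall>s\<le>r. a s \<in> S) \<and> (\<forall>s<r. a s + 2 \<le> a (Suc s)))"
  using assms
proof (induction r arbitrary: S)
  case 0
  then show ?case by (cases "S = {}") auto
next
  case (Suc r)
  show ?case
  proof (cases "S = {}")
    case False
    let ?b = "Min S" and ?T = "S - {Min S, Suc (Min S)}"
    have above: "?b + 2 \<le> x" if "x \<in> ?T" for x
    proof -
      have "?b \<le> x" using that Suc.prems by simp
      moreover have "x \<noteq> ?b" "x \<noteq> Suc ?b" using that by auto
      ultimately show ?thesis by linarith
    qed
    from Suc.IH[of ?T] Suc.prems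
    consider b where "?T \<subseteq> (\<Union>j<r. {b j, Suc (b j)})"
      | a where "\<forall>s\<le>r. a s \<in> ?T" "\<forall>s<r. a s + 2 \<le> a (Suc s)" by auto
    then show ?thesis
    proof cases
      case 1
      have "S \<subseteq> (\<Union>j<Suc r. {(b(r := ?b)) j, Suc ((b(r := ?b)) j)})"
      proof
        fix x assume "x \<in> S"
        then consider "x \<in> {?b, Suc ?b}" | "x \<in> ?T" by blast
        then show "x \<in> (\<Union>j<Suc r. {(b(r := ?b)) j, Suc ((b(r := ?b)) j)})"
        proof cases
          case 1
          then show ?thesis by (intro UN_I[of r]) auto
        next
          case 2
          with \<open>?T \<subseteq> _\<close> obtain j where "j < r" "x \<in> {b j, Suc (b j)}" by blast
          then show ?thesis by (intro UN_I[of j]) auto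
        qed
      qed
      then show ?thesis by blast
    next
      case 2
      let ?a = "case_nat ?b a"
      have "?a s \<in> S" if "s \<le> Suc r" for s
        using 2(1) that False Suc.prems by (cases s) auto
      moreover have "?a s + 2 \<le> ?a (Suc s)" if "s < Suc r" for s
        using 2 above that by (cases s) auto
      ultimately show ?thesis by blast
    qed
  qed auto
qed

section \<open>Points on secants of the rational normal curve\<close>

lemma lookup_mult_single:
  fixes p :: "'a::comm_semiring_1 mpolynomial"
  shows "Poly_Mapping.lookup (p * Poly_Mapping.single a 1) (l + a) = Poly_Mapping.lookup p l"
  using lookup_single_mult[of a 1 p l] by (simp add: ac_simps)

lemma keys_mult_single:
  fixes p :: "'a::comm_semiring_1 mpolynomial"
  assumes "k \<in> Poly_Mapping.keys (p * Poly_Mapping.single a 1)"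
  obtains l where "l \<in> Poly_Mapping.keys p" "k = l + a"
proof -
  from subsetD[OF keys_mult assms] obtain l b where
    l: "l \<in> Poly_Mapping.keys p" "b \<in> Poly_Mapping.keys (Poly_Mapping.single a (1::'a))" "k = l + b" by blast
  from l(2) have "b = a" by (simp split: if_splits)
  with l that show thesis by blast
qed

text \<open>
  The variables \<open>2 * j\<close> and \<open>2 * j + 1\<close> play the roles of \<open>c\<^sub>j\<close> and \<open>t\<^sub>j\<close>. This is the exponent of the
  monomial \<open>c\<^sub>j\<^sup>d * t\<^sub>j\<^sup>e\<close>, where \<open>d\<close> is the degree of \<open>N\<close> and \<open>e\<close> its index sum: the image of \<open>N\<close> under
  \<open>x\<^sub>i \<mapsto> c\<^sub>j * t\<^sub>j\<^sup>i\<close>.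
\<close>

definition secant_key :: "nat \<Rightarrow> (nat \<Rightarrow>\<^sub>0 nat) \<Rightarrow> nat \<Rightarrow>\<^sub>0 nat" where
  "secant_key j N = Poly_Mapping.single (2 * j) (nat (mdeg N)) + Poly_Mapping.single (2 * j + 1) (nat (mindex N))"

text \<open>
  The \<open>i\<close>-th coordinate \<open>\<Sum>j<r. c\<^sub>j * t\<^sub>j\<^sup>i\<close> of the generic point on an \<open>r\<close>-secant.
\<close>

definition secant_point :: "nat \<Rightarrow> nat \<Rightarrow> 'a::comm_ring_1 mpolynomial" where
  "secant_point r i = (\<Sum>j<r. Poly_Mapping.single (secant_key j (Poly_Mapping.single i 1)) 1)"

definition tuple_key :: "nat \<Rightarrow> (nat \<Rightarrow> nat \<Rightarrow>\<^sub>0 nat) \<Rightarrow> nat \<Rightarrow>\<^sub>0 nat" where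
  "tuple_key r F = (\<Sum>j<r. secant_key j (F j))"

lemma secant_key_add: "secant_key j (M + N) = secant_key j M + secant_key j N"
  by (simp add: secant_key_def wsum_add nat_add_distrib wsum_nonneg single_add ac_simps)

lemma secant_key_zero [simp]: "secant_key j 0 = 0"
  by (simp add: secant_key_def)

lemma sum_update_add:
  fixes g :: "nat \<Rightarrow> 'b::plus \<Rightarrow> 'c::comm_monoid_add"
  assumes j: "j < (r::nat)" and g: "g j (F j + N) = g j (F j) + g j N"
  shows "(\<Sum>l<r. g l ((F(j := F j + N)) l)) = (\<Sum>l<r. g l (F l)) + g j N"
proof -
  have "(\<Sum>l<r. g l ((F(j := F j + N)) l)) = g j (F j + N) + (\<Sum>l\<in>{..<r} - {j}. g l (F l))"
    using j by (subst sum.remove[of _ j]) auto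
  also have "\<dots> = (\<Sum>l<r. g l (F l)) + g j N"
    using j by (subst (2) sum.remove[of _ j]) (auto simp: g ac_simps)
  finally show ?thesis .
qed

lemma tuple_key_update:
  "j < r \<Longrightarrow> tuple_key r (F(j := F j + N)) = tuple_key r F + secant_key j N"
  using sum_update_add[of j r secant_key F N]
  by (simp add: tuple_key_def secant_key_add del: fun_upd_apply)

lemma tuple_sum_update:
  fixes F :: "nat \<Rightarrow> nat \<Rightarrow>\<^sub>0 nat"
  shows "j < r \<Longrightarrow> (\<Sum>l<r. (F(j := F j + N)) l) = (\<Sum>l<r. F l) + N"
  using sum_update_add[of j r "\<lambda>_ x. x" F N] by simp

lemma lookup_tuple_key:
  assumes "j < r"
  shows "Poly_Mapping.lookup (tuple_key r F) (2 * j) = nat (mdeg (F j))"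
    and "Poly_Mapping.lookup (tuple_key r F) (2 * j + 1) = nat (mindex (F j))"
proof -
  have odd: "Suc (2 * l) \<noteq> 2 * k" "2 * k \<noteq> Suc (2 * l)" for k l :: nat by presburger+
  have "Poly_Mapping.lookup (tuple_key r F) (2 * j) = (\<Sum>l<r. if l = j then nat (mdeg (F l)) else 0)"
    unfolding tuple_key_def lookup_sum secant_key_def
    by (intro sum.cong) (auto simp: lookup_add lookup_single when_def odd)
  then show "Poly_Mapping.lookup (tuple_key r F) (2 * j) = nat (mdeg (F j))" using assms by simp
  have "Poly_Mapping.lookup (tuple_key r F) (2 * j + 1) = (\<Sum>l<r. if l = j then nat (mindex (F l)) else 0)"
    unfolding tuple_key_def lookup_sum secant_key_def
    by (intro sum.cong) (auto simp: lookup_add lookup_single when_def odd)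
  then show "Poly_Mapping.lookup (tuple_key r F) (2 * j + 1) = nat (mindex (F j))" using assms by simp
qed

lemma tuple_key_eq_imp:
  assumes "tuple_key r F = tuple_key r G" "j < r"
  shows "mdeg (F j) = mdeg (G j)" "mindex (F j) = mindex (G j)"
proof -
  have "nat (mdeg (F j)) = nat (mdeg (G j))" "nat (mindex (F j)) = nat (mindex (G j))"
    using lookup_tuple_key[OF assms(2), of F] lookup_tuple_key[OF assms(2), of G] assms(1) by simp_all
  then show "mdeg (F j) = mdeg (G j)" "mindex (F j) = mindex (G j)"
    by (simp_all add: wsum_nonneg eq_nat_nat_iff)
qed

lemma monomial_induct [case_names zero step]:
  fixes N :: "nat \<Rightarrow>\<^sub>0 nat"
  assumes zero: "P 0" and step: "\<And>N i. P N \<Longrightarrow> P (N + Poly_Mapping.single i 1)"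
  shows "P N"
proof (induction "nat (mdeg N)" arbitrary: N rule: less_induct)
  case less
  show ?case
  proof (cases "N = 0")
    case False
    then have "Poly_Mapping.keys N \<noteq> {}" by simp
    then obtain i where i: "i \<in> Poly_Mapping.keys N" by blast
    let ?M = "N - Poly_Mapping.single i 1"
    have N: "N = ?M + Poly_Mapping.single i 1"
      using i by (intro poly_mapping_eqI) (auto simp: lookup_add lookup_minus lookup_single when_def in_keys_iff)
    have "mdeg N = mdeg ?M + 1" by (subst N) (simp add: wsum_add)
    moreover have "mdeg ?M \<ge> 0" by (simp add: wsum_nonneg)
    ultimately have "nat (mdeg ?M) < nat (mdeg N)" by linarith
    from step[OF less[OF this]] N show ?thesis by metis
  qed (simp add: zero)
qed

lemma monom_subst_secant_step:
  "monom_subst (secant_point r) (N + Poly_Mapping.single i 1)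
    = (\<Sum>j<r. monom_subst (secant_point r) N * Poly_Mapping.single (secant_key j (Poly_Mapping.single i 1)) 1)"
  unfolding monom_subst_add by (simp add: secant_point_def sum_distrib_left)

text \<open>
  Multiplying out the image of \<open>N\<close> assigns each variable of \<open>N\<close> to one of the \<open>r\<close> summands. The
  monomials that occur therefore come from the ways of splitting \<open>N\<close> into \<open>r\<close> factors.
\<close>

lemma monom_subst_secant_keys:
  assumes "k \<in> Poly_Mapping.keys (monom_subst (secant_point r) N :: 'a::comm_ring_1 mpolynomial)"
  shows "\<exists>F. N = (\<Sum>j<r. F j) \<and> k = tuple_key r F"
  using assms
proof (induction N arbitrary: k rule: monomial_induct)
  case zero
  then show ?case by (intro exI[of _ "\<lambda>_. 0"]) (simp add: tuple_key_def)
next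
  case (step N i)
  let ?M = "monom_subst (secant_point r) N :: 'a mpolynomial" and ?e = "Poly_Mapping.single i (1::nat)"
  from subsetD[OF Poly_Mapping.keys_sum step.prems[unfolded monom_subst_secant_step]]
  obtain j where j: "j < r" "k \<in> Poly_Mapping.keys (?M * Poly_Mapping.single (secant_key j ?e) 1)" by blast
  from keys_mult_single[OF j(2)] obtain l where l: "l \<in> Poly_Mapping.keys ?M" "k = l + secant_key j ?e" .
  from step.IH[OF l(1)] obtain F where F: "N = (\<Sum>j<r. F j)" "l = tuple_key r F" by blast
  show ?case
    using F l(2) tuple_key_update[OF j(1), of F ?e] tuple_sum_update[OF j(1), of F ?e]
    by (intro exI[of _ "F(j := F j + ?e)"]) (simp del: fun_upd_apply)
qed

lemma sum_in_Nats: "(\<And>x. x \<in> S \<Longrightarrow> f x \<in> \<nat>) \<Longrightarrow> sum f S \<in> (\<nat> :: 'a::semiring_1 set)"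
  by (induction S rule: infinite_finite_induct) auto

lemma monom_subst_secant_Nats:
  "Poly_Mapping.lookup (monom_subst (secant_point r) N :: 'a::comm_ring_1 mpolynomial) k \<in> \<nat>"
proof (induction N arbitrary: k rule: monomial_induct)
  case zero
  then show ?case by (simp add: lookup_one when_def)
next
  case (step N i)
  let ?M = "monom_subst (secant_point r) N :: 'a mpolynomial"
  have "Poly_Mapping.lookup (?M * Poly_Mapping.single a 1) k \<in> \<nat>" for a
  proof (cases "k \<in> Poly_Mapping.keys (?M * Poly_Mapping.single a 1)")
    case True
    then obtain l where "k = l + a" by (rule keys_mult_single)
    then show ?thesis using step by (simp add: lookup_mult_single)
  qed (simp add: in_keys_iff)
  then show ?case unfolding monom_subst_secant_step lookup_sum by (rule sum_in_Nats)
qed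

lemma sum_Nats_nonzero:
  fixes f :: "'b \<Rightarrow> 'a::semiring_char_0"
  assumes "finite S" "\<And>x. x \<in> S \<Longrightarrow> f x \<in> \<nat>" "x \<in> S" "f x \<noteq> 0"
  shows "sum f S \<noteq> 0"
proof -
  have "\<exists>n. f x = of_nat n" if "x \<in> S" for x using assms(2)[OF that] by (auto elim: Nats_cases)
  then obtain n where n: "\<And>x. x \<in> S \<Longrightarrow> f x = of_nat (n x)" by metis
  then have "sum f S = of_nat (sum n S)" by simp
  moreover have "n x \<noteq> 0" using assms n by (metis of_nat_0)
  then have "sum n S \<noteq> 0" using assms(1,3) by auto
  ultimately show ?thesis by (simp only: of_nat_eq_0_iff not_False_eq_True)
qed

text \<open>
  Conversely, each splitting contributes: the coefficients are natural numbers, so that in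
  characteristic zero no cancellation occurs.
\<close>

lemma monom_subst_secant_nonzero:
  "Poly_Mapping.lookup (monom_subst (secant_point r) (\<Sum>j<r. F j) :: 'k::field_char_0 mpolynomial) (tuple_key r F) \<noteq> 0"
proof -
  have "Poly_Mapping.lookup (monom_subst (secant_point r) N :: 'k mpolynomial) (tuple_key r F) \<noteq> 0"
    if "N = (\<Sum>j<r. F j)" for N
    using that
  proof (induction N arbitrary: F rule: monomial_induct)
    case zero
    have "F j = 0" if "j < r" for j
    proof (rule poly_mapping_eqI)
      fix i
      have "(\<Sum>l<r. Poly_Mapping.lookup (F l) i) = 0" using zero by (metis lookup_sum lookup_zero)
      then show "Poly_Mapping.lookup (F j) i = Poly_Mapping.lookup 0 i" using that by simp
    qed
    then have "tuple_key r F = 0" by (simp add: tuple_key_def)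
    then show ?case by simp
  next
    case (step N i)
    let ?e = "Poly_Mapping.single i (1::nat)"
    let ?M = "monom_subst (secant_point r) N :: 'k mpolynomial"
    have "(\<Sum>l<r. Poly_Mapping.lookup (F l) i) = Poly_Mapping.lookup (N + ?e) i"
      unfolding step.prems lookup_sum ..
    then have "(\<Sum>l<r. Poly_Mapping.lookup (F l) i) \<noteq> 0" by (simp add: lookup_add)
    then obtain j where j: "j < r" "Poly_Mapping.lookup (F j) i \<noteq> 0" by auto
    define G where "G = F(j := F j - ?e)"
    have "F j - ?e + ?e = F j"
      using j(2) by (intro poly_mapping_eqI) (auto simp: lookup_add lookup_minus lookup_single when_def)
    then have F: "F = G(j := G j + ?e)" by (simp add: G_def)
    have "N + ?e = (\<Sum>l<r. G l) + ?e"
      unfolding step.prems by (subst F) (rule tuple_sum_update[OF j(1)])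
    then have "N = (\<Sum>l<r. G l)" by simp
    note IH = step.IH[OF this]
    have key: "tuple_key r F = tuple_key r G + secant_key j ?e"
      by (subst F) (rule tuple_key_update[OF j(1)])
    have Nats: "Poly_Mapping.lookup (?M * Poly_Mapping.single a 1) k \<in> \<nat>" for a k
    proof (cases "k \<in> Poly_Mapping.keys (?M * Poly_Mapping.single a 1)")
      case True
      then obtain l where "k = l + a" by (rule keys_mult_single)
      then show ?thesis by (simp add: lookup_mult_single monom_subst_secant_Nats)
    qed (simp add: in_keys_iff)
    show ?case
      unfolding monom_subst_secant_step lookup_sum
    proof (rule sum_Nats_nonzero[of _ _ j])
      show "Poly_Mapping.lookup (?M * Poly_Mapping.single (secant_key j ?e) 1) (tuple_key r F) \<noteq> 0"
        unfolding key lookup_mult_single by (rule IH)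
    qed (use Nats j in auto)
  qed
  then show ?thesis by simp
qed

lemma coverable_decomposition:
  fixes N :: "nat \<Rightarrow>\<^sub>0 nat" and r :: nat
  assumes "Poly_Mapping.keys N \<subseteq> (\<Union>j<r. {b j, Suc (b j)})"
  shows "\<exists>F. N = (\<Sum>j<r. F j) \<and> (\<forall>j<r. Poly_Mapping.keys (F j) \<subseteq> {b j, Suc (b j)})"
  using assms
proof (induction N rule: monomial_induct)
  case zero
  show ?case by (intro exI[of _ "\<lambda>_. 0"]) simp
next
  case (step N i)
  let ?e = "Poly_Mapping.single i (1::nat)"
  have "Poly_Mapping.keys (N + ?e) = insert i (Poly_Mapping.keys N)"
    by (auto simp: in_keys_iff lookup_add lookup_single when_def split: if_splits)
  with step obtain F j where F: "N = (\<Sum>j<r. F j)" "\<forall>j<r. Poly_Mapping.keys (F j) \<subseteq> {b j, Suc (b j)}"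
    and j: "j < r" "i \<in> {b j, Suc (b j)}" by auto
  have "Poly_Mapping.keys (F j + ?e) \<subseteq> {b j, Suc (b j)}"
    using F(2) j Poly_Mapping.keys_add[of "F j" ?e] by auto
  then show ?case using F tuple_sum_update[OF j(1), of F ?e]
    by (intro exI[of _ "F(j := F j + ?e)"]) (simp del: fun_upd_apply, simp)
qed

text \<open>
  Take a heaviest monomial \<open>N\<close> of \<open>p\<close>, split it into factors supported on neighbouring variables,
  and compare coefficients at the key of this splitting. Another monomial contributing there
  splits into factors of the same degrees and index sums, so it is strictly heavier than \<open>N\<close>.
\<close>

theorem coverable_independent:
  fixes p :: "'k::field_char_0 mpolynomial"
  assumes std: "\<And>N. N \<in> Poly_Mapping.keys p \<Longrightarrow> coverable r N"
    and zero: "poly_subst (secant_point r) p = 0"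
  shows "p = 0"
proof (rule ccontr)
  assume "p \<noteq> 0"
  then have ne: "Poly_Mapping.keys p \<noteq> {}" by simp
  let ?M = "\<lambda>N. monom_subst (secant_point r) N :: 'k mpolynomial"
  have "Max (mweight ` Poly_Mapping.keys p) \<in> mweight ` Poly_Mapping.keys p"
    using ne by (intro Max_in) auto
  then obtain N where N: "N \<in> Poly_Mapping.keys p" "mweight N = Max (mweight ` Poly_Mapping.keys p)" by auto
  have max: "mweight L \<le> mweight N" if "L \<in> Poly_Mapping.keys p" for L
    using that unfolding N(2) by (intro Max_ge) auto
  obtain b where "Poly_Mapping.keys N \<subseteq> (\<Union>j<r. {b j, Suc (b j)})"
    using std[OF N(1)] by (auto simp: coverable_def)
  from coverable_decomposition[OF this] obtain F where
    F: "N = (\<Sum>j<r. F j)" "\<And>j. j < r \<Longrightarrow> Poly_Mapping.keys (F j) \<subseteq> {b j, Suc (b j)}" by blast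
  have other: "Poly_Mapping.lookup (?M L) (tuple_key r F) = 0"
    if L: "L \<in> Poly_Mapping.keys p" "L \<noteq> N" for L
  proof (rule ccontr)
    assume "Poly_Mapping.lookup (?M L) (tuple_key r F) \<noteq> 0"
    then have "tuple_key r F \<in> Poly_Mapping.keys (?M L)" by (simp add: in_keys_iff)
    from monom_subst_secant_keys[OF this] obtain G where
      G: "L = (\<Sum>j<r. G j)" "tuple_key r F = tuple_key r G" by blast
    have bal: "mweight (F j) \<le> mweight (G j)" "mweight (F j) = mweight (G j) \<Longrightarrow> F j = G j" if "j < r" for j
      using balanced_minimal_weight[OF F(2)[OF that], of "G j"] tuple_key_eq_imp[OF G(2) that] by auto
    have "(\<Sum>j<r. mweight (G j)) \<le> (\<Sum>j<r. mweight (F j))"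
      using max[OF L(1)] unfolding F(1) G(1) wsum_sum .
    moreover have "(\<Sum>j<r. mweight (F j)) \<le> (\<Sum>j<r. mweight (G j))"
      by (intro sum_mono) (simp add: bal(1))
    ultimately have "(\<Sum>j<r. mweight (F j)) = (\<Sum>j<r. mweight (G j))" by simp
    then have "(\<Sum>j<r. mweight (G j) - mweight (F j)) = 0" by (simp add: sum_subtractf)
    then have "\<forall>j\<in>{..<r}. mweight (G j) - mweight (F j) = 0"
      by (subst (asm) sum_nonneg_eq_0_iff) (auto simp: bal(1))
    then have "F j = G j" if "j < r" for j using bal(2)[OF that] that by auto
    then have "L = N" unfolding F(1) G(1) by (intro sum.cong) auto
    with L show False by simp
  qed
  have const: "Poly_Mapping.lookup (Poly_Mapping.single 0 c * q) k = c * Poly_Mapping.lookup q k"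
    for c :: 'k and q :: "'k mpolynomial" and k
    using lookup_single_mult[of 0 c q k] by simp
  have "0 = Poly_Mapping.lookup (poly_subst (secant_point r) p) (tuple_key r F)" by (simp add: zero)
  also have "\<dots> = (\<Sum>L\<in>Poly_Mapping.keys p. Poly_Mapping.lookup p L * Poly_Mapping.lookup (?M L) (tuple_key r F))"
    unfolding poly_subst_def lookup_sum const ..
  also have "\<dots> = (\<Sum>L\<in>Poly_Mapping.keys p. if L = N then Poly_Mapping.lookup p L * Poly_Mapping.lookup (?M L) (tuple_key r F) else 0)"
    by (intro sum.cong) (auto simp: other)
  also have "\<dots> = Poly_Mapping.lookup p N * Poly_Mapping.lookup (?M N) (tuple_key r F)" using N by simp
  finally show False
    using N(1) monom_subst_secant_nonzero[of r F, where 'k = 'k] F(1) by (simp add: in_keys_iff)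
qed

section \<open>Leading terms of Hankel minors\<close>

text \<open>
  The rearrangement inequality with its case of equality. If the last value is not in place, putting
  it there by a transposition strictly increases the sum.
\<close>

lemma rearrangement:
  fixes u v :: "nat \<Rightarrow> int"
  assumes u: "strict_mono u" and v: "strict_mono v" and \<sigma>: "\<sigma> permutes {..<n}"
  shows "(\<Sum>s<n. u s * v (\<sigma> s)) \<le> (\<Sum>s<n. u s * v s) \<and>
    ((\<Sum>s<n. u s * v (\<sigma> s)) = (\<Sum>s<n. u s * v s) \<longrightarrow> \<sigma> = id)"
  using \<sigma>
proof (induction n arbitrary: \<sigma>)
  case 0
  then show ?case by simp
next
  case (Suc n)
  have restrict: "\<tau> permutes {..<n}" if "\<tau> permutes {..<Suc n}" "\<tau> n = n" for \<tau>
    using that by (intro permutes_superset[OF that(1)]) (auto simp: lessThan_Suc)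
  show ?case
  proof (cases "\<sigma> n = n")
    case True
    from Suc.IH[OF restrict[OF Suc.prems True]] True show ?thesis by simp
  next
    case False
    obtain t where \<sigma>t: "\<sigma> t = n" using permutes_surj[OF Suc.prems] by (metis surjD)
    have "t \<in> {..<Suc n}" using permutes_in_image[OF Suc.prems, of t] \<sigma>t by simp
    with False \<sigma>t have t: "t < n" by (metis lessThan_iff less_antisym)
    have "\<sigma> n \<in> {..<Suc n}" using permutes_in_image[OF Suc.prems, of n] by simp
    with False have w: "\<sigma> n < n" by simp
    \<comment> \<open>Exchanging the values at \<open>n\<close> and \<open>t\<close> puts \<open>n\<close> into place.\<close>
    let ?\<tau> = "\<sigma> \<circ> transpose n t"
    have \<tau>: "?\<tau> permutes {..<Suc n}"
      using t by (intro permutes_compose[OF _ Suc.prems] permutes_swap_id) auto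
    have \<tau>n: "?\<tau> n = n" using \<sigma>t by simp
    let ?R = "{..<Suc n} - {n} - {t}"
    have split: "(\<Sum>s<Suc n. g s) = g n + (g t + sum g ?R)" for g :: "nat \<Rightarrow> int"
      using t by (subst sum.remove[of _ n], simp, simp, subst sum.remove[of _ t]) auto
    have rest: "(\<Sum>s\<in>?R. u s * v (?\<tau> s)) = (\<Sum>s\<in>?R. u s * v (\<sigma> s))"
      by (intro sum.cong) (auto simp: transpose_def)
    have "(\<Sum>s<Suc n. u s * v (?\<tau> s)) - (\<Sum>s<Suc n. u s * v (\<sigma> s)) = (u n - u t) * (v n - v (\<sigma> n))"
      unfolding split rest using \<sigma>t by (simp add: algebra_simps)
    moreover have "(u n - u t) * (v n - v (\<sigma> n)) > 0"
      using strict_monoD[OF u t] strict_monoD[OF v w] by simp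
    moreover have "(\<Sum>s<n. u s * v (?\<tau> s)) \<le> (\<Sum>s<n. u s * v s)"
      using Suc.IH[OF restrict[OF \<tau> \<tau>n]] by blast
    then have "(\<Sum>s<Suc n. u s * v (?\<tau> s)) \<le> (\<Sum>s<Suc n. u s * v s)" using \<tau>n by simp
    ultimately show ?thesis by linarith
  qed
qed

text \<open>
  The monomial \<open>x\<^bsub>a 0\<^esub> \<cdots> x\<^bsub>a (n - 1)\<^esub>\<close>; the terms of a determinant with variables as entries are of
  this form.
\<close>

definition transversal :: "nat \<Rightarrow> (nat \<Rightarrow> nat) \<Rightarrow> nat \<Rightarrow>\<^sub>0 nat" where
  "transversal n a = (\<Sum>s<n. Poly_Mapping.single (a s) 1)"

lemma mweight_transversal: "mweight (transversal n a) = (\<Sum>s<n. int (a s) ^ 2)"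
  by (simp add: transversal_def wsum_sum)

lemma keys_transversal: "Poly_Mapping.keys (transversal n a) = a ` {..<n}"
  by (auto simp: transversal_def in_keys_iff lookup_sum lookup_single when_def split: if_splits)

text \<open>
  Squaring out, only the mixed terms depend on \<open>\<sigma>\<close>, and the rearrangement inequality applies to
  them.
\<close>

lemma transversal_weight_less:
  fixes u v :: "nat \<Rightarrow> nat"
  assumes u: "strict_mono u" and v: "strict_mono v" and \<sigma>: "\<sigma> permutes {..<n}" "\<sigma> \<noteq> id"
  shows "mweight (transversal n (\<lambda>s. u s + v (\<sigma> s))) < mweight (transversal n (\<lambda>s. u s + v s))"
proof -
  have "strict_mono (\<lambda>s. int (u s))" "strict_mono (\<lambda>s. int (v s))"
    using u v by (auto simp: strict_mono_def)
  from rearrangement[OF this \<sigma>(1)] \<sigma>(2)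
  have less: "(\<Sum>s<n. int (u s) * int (v (\<sigma> s))) < (\<Sum>s<n. int (u s) * int (v s))"
    using order_less_le by blast
  have sq: "(\<Sum>s<n. int (v (\<sigma> s)) ^ 2) = (\<Sum>s<n. int (v s) ^ 2)"
    using sum.permute[OF \<sigma>(1), of "\<lambda>s. int (v s) ^ 2"] by (simp add: o_def)
  have expand: "(\<Sum>s<n. int (u s + w s) ^ 2)
      = (\<Sum>s<n. int (u s) ^ 2) + (\<Sum>s<n. int (w s) ^ 2) + 2 * (\<Sum>s<n. int (u s) * int (w s))" for w
    by (simp add: power2_sum sum.distrib sum_distrib_left mult.assoc)
  show ?thesis unfolding mweight_transversal expand sq using less by simp
qed

lemma prod_Var: "finite S \<Longrightarrow> (\<Prod>s\<in>S. Var (a s)) = Poly_Mapping.single (\<Sum>s\<in>S. Poly_Mapping.single (a s) 1) 1"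
  by (induction S rule: finite_induct) (simp_all add: Var_def mult_single)

lemma det_Var_sum_diagonal:
  fixes u v :: "nat \<Rightarrow> nat"
  obtains E where
    "det (mat n n (\<lambda>(s,t). Var (u s + v t)) :: 'a::comm_ring_1 mpolynomial mat)
      = Poly_Mapping.single (transversal n (\<lambda>s. u s + v s)) 1 + E"
    and "\<And>k. k \<in> Poly_Mapping.keys E \<Longrightarrow>
      \<exists>\<sigma>. \<sigma> permutes {..<n} \<and> \<sigma> \<noteq> id \<and> k = transversal n (\<lambda>s. u s + v (\<sigma> s))"
proof
  let ?P = "{\<sigma>. \<sigma> permutes {..<n}}"
  let ?t = "\<lambda>\<sigma>. signof \<sigma> * Poly_Mapping.single (transversal n (\<lambda>s. u s + v (\<sigma> s))) 1 :: 'a mpolynomial"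
  have "det (mat n n (\<lambda>(s,t). Var (u s + v t)) :: 'a mpolynomial mat) = sum ?t ?P"
  proof (subst det_def'[of _ n])
    have "(\<Prod>i=0..<n. mat n n (\<lambda>(s,t). Var (u s + v t)) $$ (i, \<sigma> i))
        = (Poly_Mapping.single (transversal n (\<lambda>s. u s + v (\<sigma> s))) 1 :: 'a mpolynomial)"
      if \<sigma>: "\<sigma> permutes {..<n}" for \<sigma>
    proof -
      have "\<sigma> i < n" if "i < n" for i using permutes_in_image[OF \<sigma>, of i] that by simp
      then have "(\<Prod>i=0..<n. mat n n (\<lambda>(s,t). Var (u s + v t)) $$ (i, \<sigma> i))
          = (\<Prod>i<n. Var (u i + v (\<sigma> i)) :: 'a mpolynomial)"
        by (intro prod.cong) auto
      then show ?thesis by (simp add: prod_Var transversal_def)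
    qed
    then show "(\<Sum>\<sigma> | \<sigma> permutes {0..<n}. signof \<sigma> * (\<Prod>i=0..<n. mat n n (\<lambda>(s,t). Var (u s + v t)) $$ (i, \<sigma> i))) = sum ?t ?P"
      by (intro sum.cong) (auto simp: atLeast0LessThan)
  qed simp
  also have "\<dots> = ?t id + sum ?t (?P - {id})"
    by (intro sum.remove) (auto simp: permutes_id finite_permutations)
  finally show "det (mat n n (\<lambda>(s,t). Var (u s + v t)) :: 'a mpolynomial mat)
      = Poly_Mapping.single (transversal n (\<lambda>s. u s + v s)) 1 + sum ?t (?P - {id})" by simp
  fix k assume "k \<in> Poly_Mapping.keys (sum ?t (?P - {id}))"
  from subsetD[OF Poly_Mapping.keys_sum this] obtain \<sigma> where
    \<sigma>: "\<sigma> permutes {..<n}" "\<sigma> \<noteq> id" "k \<in> Poly_Mapping.keys (?t \<sigma>)" by blast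
  then show "\<exists>\<sigma>. \<sigma> permutes {..<n} \<and> \<sigma> \<noteq> id \<and> k = transversal n (\<lambda>s. u s + v (\<sigma> s))"
    by (intro exI[of _ \<sigma>]) (auto simp: sign_def split: if_splits)
qed

lemma det_hankel_keys:
  assumes "k \<in> Poly_Mapping.keys (det (hankel n) :: 'a::comm_ring_1 mpolynomial)"
  shows "card (Poly_Mapping.keys k) \<le> n"
proof -
  have H: "mat n n (\<lambda>(s,t). Var (id s + id t)) = (hankel n :: 'a mpolynomial mat)"
    by (simp add: hankel_def)
  obtain E where E: "det (hankel n) = Poly_Mapping.single (transversal n (\<lambda>s. id s + id s)) 1 + (E :: 'a mpolynomial)"
    "\<And>k. k \<in> Poly_Mapping.keys E \<Longrightarrow>
      \<exists>\<sigma>. \<sigma> permutes {..<n} \<and> \<sigma> \<noteq> id \<and> k = transversal n (\<lambda>s. id s + id (\<sigma> s))"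
    by (rule det_Var_sum_diagonal[of n id id, where 'a = 'a, unfolded H]) (rule that)
  have "\<exists>a. k = transversal n a"
    using subsetD[OF Poly_Mapping.keys_add assms[unfolded E(1)]] E(2)[of k] by (auto split: if_splits)
  then obtain a where "k = transversal n a" by blast
  then show ?thesis using card_image_le[of "{..<n}" a] by (simp add: keys_transversal)
qed

lemma det_hankel_nonzero: "det (hankel n) \<noteq> (0 :: 'a::comm_ring_1 mpolynomial)"
proof
  assume zero: "det (hankel n) = (0 :: 'a mpolynomial)"
  have H: "mat n n (\<lambda>(s,t). Var (id s + id t)) = (hankel n :: 'a mpolynomial mat)"
    by (simp add: hankel_def)
  let ?d = "transversal n (\<lambda>s. id s + id s)"
  obtain E where E: "det (hankel n) = Poly_Mapping.single ?d 1 + (E :: 'a mpolynomial)"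
    "\<And>k. k \<in> Poly_Mapping.keys E \<Longrightarrow>
      \<exists>\<sigma>. \<sigma> permutes {..<n} \<and> \<sigma> \<noteq> id \<and> k = transversal n (\<lambda>s. id s + id (\<sigma> s))"
    by (rule det_Var_sum_diagonal[of n id id, where 'a = 'a, unfolded H]) (rule that)
  have "?d \<notin> Poly_Mapping.keys E"
  proof
    assume "?d \<in> Poly_Mapping.keys E"
    from E(2)[OF this] obtain \<sigma> where "\<sigma> permutes {..<n}" "\<sigma> \<noteq> id"
      "?d = transversal n (\<lambda>s. id s + id (\<sigma> s))" by blast
    then show False using transversal_weight_less[of id id \<sigma> n] by (simp add: strict_mono_def)
  qed
  then have "Poly_Mapping.lookup (det (hankel n)) ?d = (1 :: 'a)"
    unfolding E(1) by (simp add: lookup_add in_keys_iff)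
  with zero show False by simp
qed

lemma mat_delete_hankel:
  assumes "p < m" "q < m"
  shows "mat_delete (hankel m) p q = mat (m - 1) (m - 1) (\<lambda>(s,t). Var (insert_index p s + insert_index q t))"
  using assms by (intro eq_matI) (auto simp: mat_delete_def hankel_def insert_index_def)

lemma strict_mono_insert_index: "strict_mono (insert_index p)"
  by (auto simp: strict_mono_def insert_index_def)

text \<open>
  For a chain \<open>a\<close> of this length inside \<open>{0..2 * r + 2}\<close> the excess \<open>a s - 2 * s\<close> is nondecreasing
  with values in \<open>{0, 1, 2}\<close>. On the diagonal of the minor that omits row \<open>p\<close> and column \<open>q\<close>, the
  excess of the index counts how many of \<open>p\<close> and \<open>q\<close> have been passed. So \<open>q\<close> and \<open>p\<close> are the
  positions at which the excess reaches 1 and 2.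
\<close>

lemma chain_is_minor_diagonal:
  assumes gap: "\<forall>s<r. a s + 2 \<le> a (Suc s)" and top: "a r \<le> 2 * r + 2"
  obtains p q where "p < r + 2" "q < r + 2" "\<And>s. s \<le> r \<Longrightarrow> insert_index p s + insert_index q s = a s"
proof
  have spread: "a s + 2 * d \<le> a (s + d)" if "s + d \<le> r" for s d
    using that
  proof (induction d)
    case (Suc d)
    then have "a (s + d) + 2 \<le> a (Suc (s + d))" using gap by auto
    then show ?case using Suc by simp
  qed simp
  \<comment> \<open>The first position of excess at least \<open>k\<close>; the alternative \<open>r + 1\<close> keeps it defined when there is
    none.\<close>
  define thr where "thr k = (LEAST s. s = r + 1 \<or> a s \<ge> 2 * s + k)" for k
  have thr: "thr k = r + 1 \<or> a (thr k) \<ge> 2 * thr k + k" "thr k \<le> r + 1" for k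
    unfolding thr_def by (rule LeastI[of _ "r + 1"], simp) (rule Least_le, simp)
  have iff: "s < thr k \<longleftrightarrow> a s < 2 * s + k" if s: "s \<le> r" for s k
  proof
    assume "s < thr k"
    from not_less_Least[OF this[unfolded thr_def]] show "a s < 2 * s + k" by simp
  next
    assume small: "a s < 2 * s + k"
    show "s < thr k"
    proof (rule ccontr)
      assume "\<not> s < thr k"
      then have le: "thr k \<le> s" by simp
      with s thr(1)[of k] have "a (thr k) \<ge> 2 * thr k + k" by auto
      moreover have "a (thr k) + 2 * (s - thr k) \<le> a s" using spread[of "thr k" "s - thr k"] le s by simp
      ultimately show False using small le by linarith
    qed
  qed
  show "thr 2 < r + 2" "thr 1 < r + 2" using thr(2)[of 1] thr(2)[of 2] by auto
  fix s assume s: "s \<le> r"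
  have "2 * s \<le> a s" using spread[of 0 s] s by simp
  moreover have "a s \<le> 2 * s + 2" using spread[of s "r - s"] s top by simp
  ultimately show "insert_index (thr 2) s + insert_index (thr 1) s = a s"
    unfolding insert_index_def iff[OF s] by auto
qed

section \<open>Straightening modulo the minors\<close>

lemma mpolynomial_sum_monomials:
  "p = (\<Sum>N\<in>Poly_Mapping.keys p. Poly_Mapping.single 0 (Poly_Mapping.lookup p N) * Poly_Mapping.single N 1)"
  for p :: "'a::comm_ring_1 mpolynomial"
proof (rule poly_mapping_eqI)
  fix k
  have "Poly_Mapping.lookup (\<Sum>N\<in>Poly_Mapping.keys p. Poly_Mapping.single 0 (Poly_Mapping.lookup p N) * Poly_Mapping.single N 1) k
      = (\<Sum>N\<in>Poly_Mapping.keys p. if N = k then Poly_Mapping.lookup p N else 0)"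
    unfolding lookup_sum mult_single by (intro sum.cong) (auto simp: lookup_single when_def)
  also have "\<dots> = Poly_Mapping.lookup p k" by (simp add: in_keys_iff)
  finally show "Poly_Mapping.lookup p k = Poly_Mapping.lookup (\<Sum>N\<in>Poly_Mapping.keys p. Poly_Mapping.single 0 (Poly_Mapping.lookup p N) * Poly_Mapping.single N 1) k" ..
qed

text \<open>
  A monomial that is not coverable contains a chain, hence the diagonal of a minor. The multiple of
  this minor with leading term \<open>N\<close> lies in the ideal, and its other terms are lighter.
\<close>

lemma straightening_step:
  assumes N: "Poly_Mapping.keys N \<subseteq> hankel_vars (r + 2)" and nc: "\<not> coverable r N"
  obtains p q K E where "p < r + 2" "q < r + 2" "Poly_Mapping.keys K \<subseteq> hankel_vars (r + 2)"
    "Poly_Mapping.single K 1 * det (mat_delete (hankel (r + 2)) p q)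
      = Poly_Mapping.single N 1 + (E :: 'a::comm_ring_1 mpolynomial)"
    "\<And>k. k \<in> Poly_Mapping.keys E \<Longrightarrow>
      Poly_Mapping.keys k \<subseteq> hankel_vars (r + 2) \<and> mweight k < mweight N"
proof -
  let ?m = "r + 2"
  have "\<not> (\<exists>b. Poly_Mapping.keys N \<subseteq> (\<Union>j<r. {b j, Suc (b j)}))" using nc by (simp add: coverable_def)
  with pairs_or_chain[OF finite_keys, of N r] obtain a where
    a: "\<And>s. s \<le> r \<Longrightarrow> a s \<in> Poly_Mapping.keys N" and gap: "\<forall>s<r. a s + 2 \<le> a (Suc s)" by blast
  have "a r \<le> 2 * r + 2" using a[of r] N by auto
  from chain_is_minor_diagonal[OF gap this] obtain p q where
    pq: "p < ?m" "q < ?m" and diag: "\<And>s. s \<le> r \<Longrightarrow> insert_index p s + insert_index q s = a s" by metis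
  let ?u = "insert_index p" and ?v = "insert_index q"
  let ?T = "transversal (r + 1) (\<lambda>s. ?u s + ?v s)"
  \<comment> \<open>The quotient of \<open>N\<close> by the diagonal term; the subtraction does not truncate, as the entries of the
    chain are distinct variables of \<open>N\<close>.\<close>
  define K where "K = N - ?T"
  have mono: "strict_mono (\<lambda>s. ?u s + ?v s)"
    using strict_mono_insert_index by (auto simp: strict_mono_def intro: add_strict_mono)
  have "Poly_Mapping.lookup ?T i \<le> Poly_Mapping.lookup N i" for i
  proof (cases "\<exists>s<r + 1. ?u s + ?v s = i")
    case True
    then obtain s where s: "s < r + 1" "?u s + ?v s = i" by blast
    have "Poly_Mapping.lookup ?T i = (\<Sum>t<r + 1. if t = s then 1 else 0)"
      unfolding transversal_def lookup_sum
      using s strict_mono_eq[OF mono] by (intro sum.cong) (auto simp: lookup_single when_def)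
    also have "\<dots> = 1" using s by simp
    also have "1 \<le> Poly_Mapping.lookup N i" using a[of s] diag[of s] s by (simp add: in_keys_iff)
    finally show ?thesis .
  next
    case False
    then have "i \<notin> Poly_Mapping.keys ?T" by (auto simp: keys_transversal)
    then show ?thesis by (simp add: in_keys_iff)
  qed
  then have NK: "N = K + ?T"
    unfolding K_def by (intro poly_mapping_eqI) (simp add: lookup_add lookup_minus)
  have KV: "Poly_Mapping.keys K \<subseteq> hankel_vars ?m"
    using N unfolding K_def by (auto simp: in_keys_iff lookup_minus subset_iff)
  obtain E where E: "det (mat_delete (hankel ?m) p q) = Poly_Mapping.single ?T 1 + (E :: 'a mpolynomial)"
    "\<And>k. k \<in> Poly_Mapping.keys E \<Longrightarrow>
      \<exists>\<sigma>. \<sigma> permutes {..<r + 1} \<and> \<sigma> \<noteq> id \<and> k = transversal (r + 1) (\<lambda>s. ?u s + ?v (\<sigma> s))"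
    using det_Var_sum_diagonal[of "r + 1" ?u ?v, where 'a = 'a] unfolding mat_delete_hankel[OF pq]
    by auto
  show thesis
  proof (rule that[OF pq KV])
    show "Poly_Mapping.single K 1 * det (mat_delete (hankel ?m) p q)
        = Poly_Mapping.single N 1 + Poly_Mapping.single K 1 * E"
      unfolding E(1) by (simp add: distrib_left mult_single NK)
    fix k assume "k \<in> Poly_Mapping.keys (Poly_Mapping.single K 1 * E)"
    from subsetD[OF keys_mult this] obtain b l where
      bl: "b \<in> Poly_Mapping.keys (Poly_Mapping.single K (1::'a))" "l \<in> Poly_Mapping.keys E" "k = b + l" by blast
    then have k: "k = K + l" by (simp split: if_splits)
    from E(2)[OF bl(2)] obtain \<sigma> where
      \<sigma>: "\<sigma> permutes {..<r + 1}" "\<sigma> \<noteq> id" "l = transversal (r + 1) (\<lambda>s. ?u s + ?v (\<sigma> s))" by blast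
    have "Poly_Mapping.keys l \<subseteq> hankel_vars ?m"
    proof
      fix i assume "i \<in> Poly_Mapping.keys l"
      then obtain s where s: "s < r + 1" "i = ?u s + ?v (\<sigma> s)" unfolding \<sigma>(3) keys_transversal by blast
      have "\<sigma> s < r + 1" using permutes_in_image[OF \<sigma>(1), of s] s by simp
      then show "i \<in> hankel_vars ?m" using s by (simp add: insert_index_def)
    qed
    then have "Poly_Mapping.keys k \<subseteq> hankel_vars ?m"
      using KV Poly_Mapping.keys_add[of K l] unfolding k by blast
    moreover have "mweight k < mweight N"
      unfolding k NK wsum_add \<sigma>(3)
      using transversal_weight_less[OF strict_mono_insert_index strict_mono_insert_index \<sigma>(1,2)] by simp
    ultimately show "Poly_Mapping.keys k \<subseteq> hankel_vars ?m \<and> mweight k < mweight N" by blast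
  qed
qed

text \<open>
  Induction on the weight of monomials, applied to each monomial of \<open>x\<close>.
\<close>

lemma straightening:
  fixes x :: "'a::comm_ring_1 mpolynomial"
  assumes x: "x \<in> carrier (poly_ring (hankel_vars (r + 2)))"
  obtains s where "x - s \<in> hankel_minors (r + 2)" "\<And>N. N \<in> Poly_Mapping.keys s \<Longrightarrow> coverable r N"
proof -
  let ?m = "r + 2"
  let ?R = "poly_ring (hankel_vars ?m) :: 'a mpolynomial ring" and ?P = "hankel_minors ?m :: 'a mpolynomial set"
  have P: "ideal ?P ?R" by (rule ideal_hankel_minors) simp
  define W where "W x \<longleftrightarrow> (\<exists>s. x - s \<in> ?P \<and> (\<forall>N\<in>Poly_Mapping.keys s. coverable r N))" for x
  have W0: "W 0" unfolding W_def using poly_ring_ideal_zero[OF P] by (intro exI[of _ 0]) simp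
  have Wadd: "W (x + y)" if xy: "W x" "W y" for x y
  proof -
    from xy obtain s t where st: "x - s \<in> ?P" "\<forall>N\<in>Poly_Mapping.keys s. coverable r N"
      "y - t \<in> ?P" "\<forall>N\<in>Poly_Mapping.keys t. coverable r N" unfolding W_def by blast
    have "(x - s) + (y - t) \<in> ?P" by (rule poly_ring_ideal_add[OF P st(1,3)])
    moreover have "\<forall>N\<in>Poly_Mapping.keys (s + t). coverable r N"
      using st Poly_Mapping.keys_add[of s t] by blast
    ultimately show ?thesis unfolding W_def by (intro exI[of _ "s + t"]) (simp add: algebra_simps)
  qed
  have Wconst: "W (Poly_Mapping.single 0 c * x)" if x: "W x" for c x
  proof -
    from x obtain s where s: "x - s \<in> ?P" "\<forall>N\<in>Poly_Mapping.keys s. coverable r N" unfolding W_def by blast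
    have "Poly_Mapping.single 0 c * (x - s) \<in> ?P"
      by (rule poly_ring_ideal_mult[OF P _ s(1)]) (simp add: poly_ring_single_closed)
    moreover have "\<forall>N\<in>Poly_Mapping.keys (Poly_Mapping.single 0 c * s). coverable r N"
    proof
      fix N assume "N \<in> Poly_Mapping.keys (Poly_Mapping.single 0 c * s)"
      from subsetD[OF keys_mult this] obtain b l where
        bl: "b \<in> Poly_Mapping.keys (Poly_Mapping.single (0 :: nat \<Rightarrow>\<^sub>0 nat) c)" "l \<in> Poly_Mapping.keys s" "N = b + l" by blast
      then have "N = l" by (simp split: if_splits)
      with s(2) bl(2) show "coverable r N" by simp
    qed
    ultimately show ?thesis unfolding W_def
      by (intro exI[of _ "Poly_Mapping.single 0 c * s"]) (simp add: right_diff_distrib)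
  qed
  have Wall: "W x" if "\<And>N. N \<in> Poly_Mapping.keys x \<Longrightarrow> W (Poly_Mapping.single N 1)" for x
  proof -
    have "W (\<Sum>N\<in>S. Poly_Mapping.single 0 (Poly_Mapping.lookup x N) * Poly_Mapping.single N 1)"
      if "S \<subseteq> Poly_Mapping.keys x" for S
      using finite_subset[OF that finite_keys] that
    proof (induction S)
      case empty
      then show ?case using W0 by simp
    next
      case (insert N S)
      then show ?case using Wadd[OF Wconst] \<open>\<And>N. N \<in> Poly_Mapping.keys x \<Longrightarrow> W (Poly_Mapping.single N 1)\<close> by simp
    qed
    from this[OF order_refl] show ?thesis by (subst mpolynomial_sum_monomials)
  qed
  have monom: "W (Poly_Mapping.single N 1)" if "Poly_Mapping.keys N \<subseteq> hankel_vars ?m" for N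
    using that
  proof (induction "nat (mweight N)" arbitrary: N rule: less_induct)
    case less
    show ?case
    proof (cases "coverable r N")
      case True
      then show ?thesis unfolding W_def using poly_ring_ideal_zero[OF P]
        by (intro exI[of _ "Poly_Mapping.single N 1"]) simp
    next
      case False
      from straightening_step[OF less.prems False, where 'a = 'a] obtain p q K E where
        pq: "p < ?m" "q < ?m" and K: "Poly_Mapping.keys K \<subseteq> hankel_vars ?m"
        and eq: "Poly_Mapping.single K 1 * det (mat_delete (hankel ?m) p q)
          = Poly_Mapping.single N 1 + (E :: 'a mpolynomial)"
        and E: "\<And>k. k \<in> Poly_Mapping.keys E \<Longrightarrow>
          Poly_Mapping.keys k \<subseteq> hankel_vars ?m \<and> mweight k < mweight N" by metis
      have "det (mat_delete (hankel ?m) p q) \<in> ?P" by (rule ideal_hankel_minors(2)[OF _ pq]) simp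
      then have "Poly_Mapping.single K 1 * det (mat_delete (hankel ?m) p q) \<in> ?P"
        by (rule poly_ring_ideal_mult[OF P poly_ring_single_closed[OF K]])
      then have first: "W (Poly_Mapping.single N 1 + E)" unfolding eq W_def by (intro exI[of _ 0]) simp
      have "W (Poly_Mapping.single k 1)" if "k \<in> Poly_Mapping.keys E" for k
      proof (rule less.hyps)
        show "nat (mweight k) < nat (mweight N)" using E[OF that] wsum_nonneg[of "\<lambda>i. int i ^ 2" k] by simp
      qed (use E[OF that] in simp)
      then have "W E" by (rule Wall)
      then have "W (Poly_Mapping.single 0 (-1) * E)" by (rule Wconst)
      moreover have "Poly_Mapping.single 0 (-1) * E = - E" by (simp add: single_uminus)
      ultimately have "W (- E)" by (simp only:)
      from Wadd[OF first this] show ?thesis by simp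
    qed
  qed
  have "W x" by (rule Wall, rule monom) (use x in \<open>auto simp: mem_carrier_poly_ring\<close>)
  then show thesis unfolding W_def using that by blast
qed

section \<open>The submaximal minors generate a prime ideal\<close>

text \<open>
  The substituted Hankel matrix is a sum of \<open>r\<close> matrices of rank one, and the minor has order
  \<open>r + 1\<close>. It factors through matrices padded by a zero column.
\<close>

lemma secant_point_kills_minors:
  assumes pq: "p < r + 2" "q < r + 2"
  shows "poly_subst (secant_point r) (det (mat_delete (hankel (r + 2)) p q)) = (0 :: 'a::comm_ring_1 mpolynomial)"
proof -
  let ?n = "r + 1" and ?u = "insert_index p" and ?v = "insert_index q"
  interpret \<phi>: comm_ring_hom "poly_subst (secant_point r) :: 'a mpolynomial \<Rightarrow> 'a mpolynomial"
    by (rule poly_subst_comm_ring_hom)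
  define c where "c k = (Poly_Mapping.single (Poly_Mapping.single (2 * k) 1) 1 :: 'a mpolynomial)" for k :: nat
  define t where "t k i = (Poly_Mapping.single (Poly_Mapping.single (2 * k + 1) i) 1 :: 'a mpolynomial)" for k i :: nat
  have point: "secant_point r (i + j) = (\<Sum>k<r. c k * t k i * t k j)" for i j
    unfolding secant_point_def
    by (intro sum.cong) (auto simp: secant_key_def c_def t_def mult_single single_add add.assoc nat_int_add)
  define A where "A = mat ?n ?n (\<lambda>(s,k). if k < r then c k * t k (?u s) else 0)"
  define B where "B = mat ?n ?n (\<lambda>(k,s). t k (?v s))"
  have AB: "A \<in> carrier_mat ?n ?n" "B \<in> carrier_mat ?n ?n" by (simp_all add: A_def B_def)
  define M where "M = mat ?n ?n (\<lambda>(s,t). Var (?u s + ?v t) :: 'a mpolynomial)"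
  have M: "mat_delete (hankel (r + 2)) p q = M"
    unfolding mat_delete_hankel[OF pq] M_def by simp
  have "map_mat (poly_subst (secant_point r)) M = A * B"
  proof (rule eq_matI)
    fix i j assume "i < dim_row (A * B)" "j < dim_col (A * B)"
    then have ij: "i < ?n" "j < ?n" using AB by auto
    have "(A * B) $$ (i,j) = (\<Sum>k<?n. A $$ (i,k) * B $$ (k,j))"
      using ij AB by (auto simp: scalar_prod_def atLeast0LessThan intro!: sum.cong)
    also have "\<dots> = (\<Sum>k<r. c k * t k (?u i) * t k (?v j))"
      using ij by (simp add: A_def B_def)
    finally show "map_mat (poly_subst (secant_point r)) M $$ (i,j) = (A * B) $$ (i,j)"
      using ij by (simp add: M_def poly_subst_Var point)
  qed (use AB in \<open>simp_all add: M_def\<close>)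
  then have "poly_subst (secant_point r) (det M) = det A * det B"
    using det_mult[OF AB] by (simp flip: \<phi>.hom_det)
  moreover have "det A = (\<Sum>i<?n. A $$ (i,r) * cofactor A i r)"
    by (rule laplace_expansion_column[OF AB(1)]) simp
  then have "det A = 0" by (simp add: A_def)
  ultimately show ?thesis unfolding M by simp
qed

text \<open>
  Modulo the minors, an element of the kernel is a combination of coverable monomials which is still
  in the kernel, and these are independent under the substitution.
\<close>

theorem hankel_minors_eq_kernel:
  "hankel_minors (r + 2) =
    {x \<in> carrier (poly_ring (hankel_vars (r + 2))). poly_subst (secant_point r) x = (0 :: 'k::field_char_0 mpolynomial)}"
    (is "?P = ?K")
proof
  let ?R = "poly_ring (hankel_vars (r + 2)) :: 'k mpolynomial ring"
  interpret \<phi>: comm_ring_hom "poly_subst (secant_point r) :: 'k mpolynomial \<Rightarrow> 'k mpolynomial"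
    by (rule poly_subst_comm_ring_hom)
  have K: "ideal ?K ?R"
    by (rule poly_ring_idealI) (auto simp: poly_ring_closed \<phi>.hom_add \<phi>.hom_mult)
  show sub: "?P \<subseteq> ?K"
  proof (rule ideal_hankel_minors(3)[OF _ K])
    fix p q assume "p < r + 2" "q < r + 2"
    then show "det (mat_delete (hankel (r + 2)) p q) \<in> ?K"
      using hankel_minor_closed secant_point_kills_minors by blast
  qed simp
  show "?K \<subseteq> ?P"
  proof
    fix x assume x: "x \<in> ?K"
    then obtain s where s: "x - s \<in> ?P" "\<And>N. N \<in> Poly_Mapping.keys s \<Longrightarrow> coverable r N"
      using straightening[of x r] by blast
    have "poly_subst (secant_point r) (x - s) = 0" using sub s(1) by blast
    then have "poly_subst (secant_point r) s = 0" using x by (simp add: \<phi>.hom_minus)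
    from coverable_independent[OF s(2) this] have "s = 0" by blast
    with s(1) show "x \<in> ?P" by simp
  qed
qed

theorem primeideal_hankel_minors:
  "primeideal (hankel_minors (r + 2) :: 'k::field_char_0 mpolynomial set) (poly_ring (hankel_vars (r + 2)))"
proof (rule primeidealI)
  let ?R = "poly_ring (hankel_vars (r + 2)) :: 'k mpolynomial ring"
  show "ideal (hankel_minors (r + 2)) ?R" by (rule ideal_hankel_minors) simp
  show "cring ?R" by (rule poly_ring_cring)
  have "1 \<notin> (hankel_minors (r + 2) :: 'k mpolynomial set)"
    unfolding hankel_minors_eq_kernel by (simp add: poly_subst_one)
  then show "carrier ?R \<noteq> hankel_minors (r + 2)" using poly_ring_one_closed by blast
  fix x y assume "x \<in> carrier ?R" "y \<in> carrier ?R" "x \<otimes>\<^bsub>?R\<^esub> y \<in> hankel_minors (r + 2)"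
  then show "x \<in> hankel_minors (r + 2) \<or> y \<in> hankel_minors (r + 2)"
    unfolding hankel_minors_eq_kernel by (auto simp: poly_subst_mult)
qed

text \<open>
  Each monomial of the minor involves at most \<open>r\<close> variables, so it is coverable, and a nonzero
  combination of coverable monomials is not in the kernel.
\<close>

lemma leading_minor_notin_hankel_minors:
  "det (hankel r) \<notin> (hankel_minors (r + 2) :: 'k::field_char_0 mpolynomial set)"
proof
  assume "det (hankel r) \<in> (hankel_minors (r + 2) :: 'k mpolynomial set)"
  then have zero: "poly_subst (secant_point r) (det (hankel r)) = (0 :: 'k mpolynomial)"
    unfolding hankel_minors_eq_kernel by blast
  have "coverable r N" if N: "N \<in> Poly_Mapping.keys (det (hankel r) :: 'k mpolynomial)" for N
  proof -
    obtain b where b: "bij_betw b {0..<card (Poly_Mapping.keys N)} (Poly_Mapping.keys N)"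
      using ex_bij_betw_nat_finite[OF finite_keys] by blast
    have "Poly_Mapping.keys N \<subseteq> (\<Union>j<r. {b j, Suc (b j)})"
      using bij_betw_imp_surj_on[OF b] det_hankel_keys[OF N] by fastforce
    then show ?thesis by (auto simp: coverable_def)
  qed
  from coverable_independent[OF this zero] det_hankel_nonzero show False by blast
qed

section \<open>The minimal component of the gradient ideal\<close>

theorem theorem3p13:
  fixes m :: nat
    and R :: "'k::field_char_0 mpolynomial ring"
    and J P :: "'k mpolynomial set"
  assumes "m \<ge> 2"
  defines "R \<equiv> poly_ring {0..2 * m - 2}"
    and "J \<equiv> gradient_ideal {0..2 * m - 2} (det (hankel m))"
    and "P \<equiv> minor_ideal {0..2 * m - 2} (m - 1) (hankel m)"
  shows "P = radical R J \<and>
         minimal_primes R J = {P} \<and>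
         (\<exists>D. minimal_primary_decomposition R J D) \<and>
         (\<forall>D. minimal_primary_decomposition R J D \<longrightarrow> {Q \<in> D. radical R Q = P} = {P})"
proof -
  obtain r where m: "m = r + 2" using assms(1) by (metis add.commute le_Suc_ex)
  have m1: "m \<ge> 1" using assms(1) by simp
  interpret R: noetherian_cring R unfolding R_def by (rule poly_ring_noetherian) simp
  have J: "ideal J R" unfolding J_def R_def by (rule ideal_hankel_gradient)
  have P: "primeideal P R" unfolding P_def R_def m by (rule primeideal_hankel_minors)
  have "J \<subseteq> P" unfolding J_def P_def by (rule hankel_gradient_subset_minors[OF m1])
  then have "radical R J \<subseteq> P" by (rule R.radical_subset_prime[OF P])
  moreover have "P \<subseteq> radical R J"
    unfolding P_def R_def J_def by (rule hankel_minors_subset_radical[OF m1])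
  ultimately have rad: "P = radical R J" by simp
  let ?s = "det (hankel r) ^ 3 :: 'k mpolynomial"
  have d: "det (hankel r) \<in> carrier R" unfolding R_def m by (rule hankel_det_closed) simp
  then have s: "?s \<in> carrier R" unfolding R_def by (rule poly_ring_power_closed)
  have "?s \<notin> P"
    using R.prime_power_mem[OF P d, of 3] leading_minor_notin_hankel_minors[of r, where 'k = 'k]
    unfolding P_def R_def m by (auto simp: poly_ring_nat_pow)
  moreover have "?s \<otimes>\<^bsub>R\<^esub> x \<in> J" if "x \<in> P" for x
    using leading_minor_cubed_times_minors[of x r] that unfolding P_def J_def R_def m by simp
  ultimately have "{Q \<in> D. radical R Q = P} = {P}" if "minimal_primary_decomposition R J D" for D
    using R.component_of_generically_reduced[OF J P rad s _ _ that] by blast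
  with rad R.minimal_primes_of_prime_radical[OF J P rad] R.minimal_primary_decomposition_exists[OF J]
  show ?thesis by blast
qed

end
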